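(* For the facilitated totally asymmetric simple exclusion process (FTASEP) $(\eta_t)_{t\ge0}$ on $\mathbb{Z}$ started from the Bernoulli product measure $\nu_\rho$, the freezing time $\tau_0$ at the origin satisfies $$\mathbf{P}_{\nu_\rho}(\tau_0<\infty)=\begin{cases}1 & \text{if } 0<\rho<1/2,\\ 0 & \text{if } 1/2\le\rho<1.\end{cases}$$
   Context: State space: $\mathbf{X}=\{0,1\}^{\mathbb{Z}}$; $\eta(x)=1$ means there is a particle at $x$, $\eta(x)=0$ a hole. FTASEP: the Feller Markov process $(\eta_t)_{t\ge 0}$ on $\mathbf{X}$ whose infinitesimal generator acts on cylinder functions $f$ (functions depending on finitely many coordinates) by $$\mathcal{L}f(\eta)=\sum_{x\in\mathbb{Z}}\eta(x-1)\eta(x)[1-\eta(x+1)]\,[f(\eta^{x,x+1})-f(\eta)],$$ where $\eta^{x,x+1}$ is obtained from $\eta$ by exchanging the values at $x$ and $x+1$. That is, a particle at $x$ jumps to $x+1$ at rate $1$ provided $x+1$ is empty and $x-1$ is occupied. For $\rho\in[0,1]$, $\nu_\rho$ is the product measure on $\{0,1\}^{\mathbb{Z}}$ with $\nu_\rho\{\eta:\eta(x)=1\}=\rho$ for all $x\in\mathbb{Z}$. $\mathbf{P}_\mu$ is the law on the Skorokhod space $D([0,\infty),\mathbf{X})$ of the FTASEP with initial distribution $\mu$. Freezing time at site $x$: $\tau_x:=\inf\{s:\eta_t(x)=\eta_s(x)\ \text{for all } t\ge s\}$, with $\inf\emptyset=\infty$. *)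

theory Defs
  imports "HOL-Probability.Probability"
begin

section \<open>Path space, Feller semigroups and Markov laws\<close>

text \<open>
  Paths are extensional functions on \<open>{0..}\<close>. The sigma-algebra on the space of cadlag paths is
  generated by the coordinate maps; over a Polish state space it is the Borel sigma-algebra of the
  Skorokhod topology.
\<close>

definition cadlag :: "(real \<Rightarrow> 'a::topological_space) \<Rightarrow> bool" where
  "cadlag \<omega> \<longleftrightarrow>
     (\<forall>t\<ge>0. (\<omega> \<longlongrightarrow> \<omega> t) (at_right t)) \<and> (\<forall>t>0. \<exists>l. (\<omega> \<longlongrightarrow> l) (at_left t))"

definition path_space :: "(real \<Rightarrow> 'a::topological_space) measure" where
  "path_space = restrict_space (\<Pi>\<^sub>M t\<in>{0..}. borel) {\<omega>. cadlag \<omega>}"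

definition natural_filtration :: "real \<Rightarrow> (real \<Rightarrow> 'a::topological_space) measure" where
  "natural_filtration s =
     vimage_algebra (space path_space) (\<lambda>\<omega>. restrict \<omega> {0..s}) (\<Pi>\<^sub>M t\<in>{0..s}. borel)"

text \<open>
  On a compact state space the bounded continuous functions are all of \<open>C(X)\<close>. Contractivity
  follows from linearity, positivity and conservation of constants.
\<close>

locale feller_semigroup =
  fixes S :: "real \<Rightarrow> ('a::topological_space \<Rightarrow>\<^sub>C real) \<Rightarrow> ('a \<Rightarrow>\<^sub>C real)"
  assumes compact_space: "compact (UNIV :: 'a set)"
    and linear: "\<And>t. 0 \<le> t \<Longrightarrow> linear (S t)"
    and zero: "\<And>f. S 0 f = f"
    and semigroup: "\<And>s t f. 0 \<le> s \<Longrightarrow> 0 \<le> t \<Longrightarrow> S (s + t) f = S s (S t f)"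
    and conservative: "\<And>t. 0 \<le> t \<Longrightarrow> S t (const_bcontfun 1) = const_bcontfun 1"
    and positive: "\<And>t f. 0 \<le> t \<Longrightarrow> (\<forall>x. 0 \<le> apply_bcontfun f x) \<Longrightarrow> (\<forall>x. 0 \<le> apply_bcontfun (S t f) x)"
    and strongly_continuous: "\<And>f. ((\<lambda>t. S t f) \<longlongrightarrow> f) (at_right 0)"

text \<open>The infinitesimal generator, given by its graph; the limit is in supremum norm.\<close>

definition generator ::
  "(real \<Rightarrow> ('a::topological_space \<Rightarrow>\<^sub>C real) \<Rightarrow> ('a \<Rightarrow>\<^sub>C real)) \<Rightarrow> (('a \<Rightarrow>\<^sub>C real) \<times> ('a \<Rightarrow>\<^sub>C real)) set"
  where "generator S = {(f, g). ((\<lambda>t. (1 / t) *\<^sub>R (S t f - f)) \<longlongrightarrow> g) (at_right 0)}"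

definition markov_law ::
  "(real \<Rightarrow> ('a::topological_space \<Rightarrow>\<^sub>C real) \<Rightarrow> ('a \<Rightarrow>\<^sub>C real)) \<Rightarrow> 'a measure \<Rightarrow>
   (real \<Rightarrow> 'a) measure \<Rightarrow> bool" where
  "markov_law S \<mu> P \<longleftrightarrow>
     prob_space P \<and> sets P = sets path_space \<and>
     distr P \<mu> (\<lambda>\<omega>. \<omega> 0) = \<mu> \<and>
     (\<forall>s\<ge>0. \<forall>t\<ge>0. \<forall>f.
        AE \<omega> in P. real_cond_exp P (natural_filtration s) (\<lambda>\<omega>. apply_bcontfun f (\<omega> (s + t))) \<omega>
                  = apply_bcontfun (S t f) (\<omega> s))"


section \<open>The facilitated totally asymmetric simple exclusion process\<close>

text \<open>\<open>\<eta> x\<close> is true iff there is a particle at \<open>x\<close>; configurations carry the product topology.\<close>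

type_synonym config = "int \<Rightarrow> bool"

definition exchange :: "int \<Rightarrow> int \<Rightarrow> config \<Rightarrow> config" where
  "exchange x y \<eta> = \<eta>(x := \<eta> y, y := \<eta> x)"

definition cylinder :: "(config \<Rightarrow> real) \<Rightarrow> bool" where
  "cylinder f \<longleftrightarrow> (\<exists>A. finite A \<and> (\<forall>\<eta> \<xi>. (\<forall>x\<in>A. \<eta> x = \<xi> x) \<longrightarrow> f \<eta> = f \<xi>))"

text \<open>For a cylinder function only finitely many terms of the sum are nonzero.\<close>

definition ftasep_op :: "(config \<Rightarrow> real) \<Rightarrow> config \<Rightarrow> real" where
  "ftasep_op f \<eta> =
     (\<Sum>\<^sub>\<infinity>x\<in>UNIV. of_bool (\<eta> (x - 1)) * of_bool (\<eta> x) * (1 - of_bool (\<eta> (x + 1))) *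
        (f (exchange x (x + 1) \<eta>) - f \<eta>))"

definition ftasep_semigroup :: "(real \<Rightarrow> (config \<Rightarrow>\<^sub>C real) \<Rightarrow> (config \<Rightarrow>\<^sub>C real)) \<Rightarrow> bool" where
  "ftasep_semigroup S \<longleftrightarrow> feller_semigroup S \<and>
     (\<forall>f. cylinder (apply_bcontfun f) \<longrightarrow>
        (\<exists>g. (f, g) \<in> generator S \<and> (\<forall>\<eta>. apply_bcontfun g \<eta> = ftasep_op (apply_bcontfun f) \<eta>)))"

definition ftasep_law :: "config measure \<Rightarrow> (real \<Rightarrow> config) measure \<Rightarrow> bool" where
  "ftasep_law \<mu> P \<longleftrightarrow> (\<exists>S. ftasep_semigroup S \<and> markov_law S \<mu> P)"

definition bernoulli_product :: "real \<Rightarrow> config measure" where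
  "bernoulli_product \<rho> = (\<Pi>\<^sub>M x\<in>UNIV. measure_pmf (bernoulli_pmf \<rho>))"

text \<open>In \<^typ>\<open>ereal\<close>, the infimum of the empty set is \<open>\<infinity>\<close>.\<close>

definition freezing_time :: "int \<Rightarrow> (real \<Rightarrow> config) \<Rightarrow> ereal" where
  "freezing_time x \<omega> = Inf (ereal ` {s. 0 \<le> s \<and> (\<forall>t\<ge>s. \<omega> t x = \<omega> s x)})"


section \<open>Well-definedness\<close>

instance bool :: second_countable_topology
proof
  have "open S \<longleftrightarrow> generate_topology UNIV S" for S :: "bool set"
    by (auto intro: generate_topology.Basis Topological_Spaces.open_discrete)
  then show "\<exists>B :: bool set set. countable B \<and> open = generate_topology B"
    by (intro exI[of _ UNIV]) (auto simp: uncountable_infinite)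
qed

lemma sets_borel_bool: "sets (borel :: bool measure) = UNIV"
  by (auto intro!: borel_open Topological_Spaces.open_discrete)

lemma sets_bernoulli_product: "sets (bernoulli_product \<rho>) = sets borel"
proof -
  have "sets (bernoulli_product \<rho>) = sets (\<Pi>\<^sub>M x\<in>(UNIV::int set). (borel :: bool measure))"
    unfolding bernoulli_product_def by (intro sets_PiM_cong) (auto simp: sets_borel_bool)
  then show ?thesis by (simp add: sets_PiM_equal_borel)
qed

lemma space_path_space:
  "space (path_space :: (real \<Rightarrow> 'a::topological_space) measure) = {\<omega> \<in> extensional {0..}. cadlag \<omega>}"
  by (auto simp: path_space_def space_restrict_space space_PiM PiE_def)

lemma coordinate_measurable:
  assumes "0 \<le> t"
  shows "(\<lambda>\<omega>. \<omega> t) \<in> measurable path_space borel"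
  unfolding path_space_def using assms by (intro measurable_restrict_space1) measurable

lemma subalgebra_natural_filtration:
  "subalgebra (path_space :: (real \<Rightarrow> 'a::topological_space) measure) (natural_filtration s)"
proof -
  have "(\<lambda>\<omega>. restrict \<omega> {0..s}) \<in> measurable (path_space :: (real \<Rightarrow> 'a) measure) (\<Pi>\<^sub>M t\<in>{0..s}. borel)"
    by (intro measurable_restrict coordinate_measurable) auto
  then show ?thesis
    unfolding subalgebra_def natural_filtration_def
    by (simp only: measurable_iff_sets space_vimage_algebra)
qed

lemma freezing_time_finite_iff:
  "freezing_time x \<omega> < \<infinity> \<longleftrightarrow> (\<exists>s\<ge>0. \<forall>t\<ge>s. \<omega> t x = \<omega> s x)"
proof
  assume "freezing_time x \<omega> < \<infinity>"
  then show "\<exists>s\<ge>0. \<forall>t\<ge>s. \<omega> t x = \<omega> s x"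
    unfolding freezing_time_def Inf_less_iff by auto
next
  assume "\<exists>s\<ge>0. \<forall>t\<ge>s. \<omega> t x = \<omega> s x"
  then show "freezing_time x \<omega> < \<infinity>"
    unfolding freezing_time_def Inf_less_iff by auto
qed

lemma cylinder_ftasep_op_finite:
  assumes "cylinder f"
  shows "finite {x. f (exchange x (x + 1) \<eta>) - f \<eta> \<noteq> 0}"
proof -
  from assms obtain A where A: "finite A" "\<And>\<eta> \<xi>. (\<forall>x\<in>A. \<eta> x = \<xi> x) \<Longrightarrow> f \<eta> = f \<xi>"
    unfolding cylinder_def by blast
  have "x \<in> A \<union> (\<lambda>y. y - 1) ` A" if "f (exchange x (x + 1) \<eta>) - f \<eta> \<noteq> 0" for x
  proof (rule ccontr)
    assume n: "x \<notin> A \<union> (\<lambda>y. y - 1) ` A"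
    then have "x \<notin> A" "x + 1 \<notin> A" by force+
    then have "f (exchange x (x + 1) \<eta>) = f \<eta>"
      by (intro A(2)) (auto simp: exchange_def)
    with that show False by simp
  qed
  then have "{x. f (exchange x (x + 1) \<eta>) - f \<eta> \<noteq> 0} \<subseteq> A \<union> (\<lambda>y. y - 1) ` A"
    by blast
  moreover have "finite (A \<union> (\<lambda>y. y - 1) ` A)" using A(1) by simp
  ultimately show ?thesis by (rule finite_subset)
qed

lemma freezing_event_measurable:
  "{\<omega> \<in> space path_space. freezing_time x \<omega> < \<infinity>} \<in> sets path_space"
proof -
  have ev: "(\<exists>s\<ge>0. \<forall>t\<ge>s. \<omega> t x = \<omega> s x) \<longleftrightarrow>
      (\<exists>n::nat. \<forall>q::rat. real n \<le> of_rat q \<longrightarrow> \<omega> (of_rat q) x = \<omega> (real n) x)"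
    if "cadlag \<omega>" for \<omega> :: "real \<Rightarrow> config"
  proof
    assume "\<exists>s\<ge>0. \<forall>t\<ge>s. \<omega> t x = \<omega> s x"
    then obtain s where s: "0 \<le> s" "\<And>t. t \<ge> s \<Longrightarrow> \<omega> t x = \<omega> s x" by blast
    obtain n :: nat where "s \<le> real n" using real_arch_simple by blast
    then have "\<omega> (of_rat q) x = \<omega> (real n) x" if "real n \<le> of_rat q" for q :: rat
      using s(2)[of "real n"] s(2)[of "of_rat q"] that by simp
    then show "\<exists>n::nat. \<forall>q::rat. real n \<le> of_rat q \<longrightarrow> \<omega> (of_rat q) x = \<omega> (real n) x" by blast
  next
    assume "\<exists>n::nat. \<forall>q::rat. real n \<le> of_rat q \<longrightarrow> \<omega> (of_rat q) x = \<omega> (real n) x"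
    then obtain n :: nat where n: "\<And>q::rat. real n \<le> of_rat q \<Longrightarrow> \<omega> (of_rat q) x = \<omega> (real n) x"
      by blast
    have "\<omega> t x = \<omega> (real n) x" if t: "t \<ge> real n" for t
    proof -
      have "0 \<le> t" using t by simp
      then have "(\<omega> \<longlongrightarrow> \<omega> t) (at_right t)" using \<open>cadlag \<omega>\<close> by (simp add: cadlag_def)
      moreover have "open {\<eta> :: config. \<eta> x = \<omega> t x}"
      proof -
        have "{\<eta> :: config. \<eta> x = \<omega> t x} = (\<lambda>\<eta>. \<eta> x) -` {\<omega> t x}" by auto
        moreover have "open ((\<lambda>\<eta> :: config. \<eta> x) -` {\<omega> t x})"
          by (intro open_vimage Topological_Spaces.open_discrete continuous_on_product_coordinates)
        ultimately show ?thesis by simp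
      qed
      ultimately have "\<forall>\<^sub>F u in at_right t. \<omega> u \<in> {\<eta>. \<eta> x = \<omega> t x}"
        by (rule topological_tendstoD) auto
      then obtain b where b: "b > t" "\<And>u. t < u \<Longrightarrow> u < b \<Longrightarrow> \<omega> u x = \<omega> t x"
        by (auto simp: eventually_at_right_field)
      obtain q :: rat where "t < of_rat q" "of_rat q < b" using of_rat_dense[OF b(1)] by blast
      then show ?thesis using b(2)[of "of_rat q"] n[of q] t by simp
    qed
    then show "\<exists>s\<ge>0. \<forall>t\<ge>s. \<omega> t x = \<omega> s x" by (metis of_nat_0_le_iff)
  qed
  have m: "{\<omega> \<in> space (path_space :: (real \<Rightarrow> config) measure). \<omega> s x = \<omega> t x} \<in> sets path_space" if "0 \<le> s" "0 \<le> t" for s t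
  proof -
    have c: "(\<lambda>\<omega> :: real \<Rightarrow> config. \<omega> u x) \<in> measurable path_space borel" if "0 \<le> u" for u
    proof -
      have "(\<lambda>\<eta> :: config. \<eta> x) \<in> borel_measurable borel"
        by (intro borel_measurable_continuous_onI continuous_on_product_coordinates)
      from measurable_compose[OF coordinate_measurable[OF that] this] show ?thesis .
    qed
    have "(\<lambda>\<omega> :: real \<Rightarrow> config. (\<omega> s x, \<omega> t x)) \<in> measurable path_space (borel \<Otimes>\<^sub>M borel)"
      by (intro measurable_Pair c that)
    then have *: "(\<lambda>\<omega> :: real \<Rightarrow> config. (\<omega> s x, \<omega> t x)) \<in> measurable path_space borel"
      by (simp add: borel_prod)
    have "open {p :: bool \<times> bool. fst p = snd p}"
    proof -
      have "{p :: bool \<times> bool. fst p = snd p} = {True} \<times> {True} \<union> {False} \<times> {False}" by auto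
      moreover have "open ({True} \<times> {True} \<union> {False} \<times> {False} :: (bool \<times> bool) set)"
        by (intro open_Un open_Times Topological_Spaces.open_discrete)
      ultimately show ?thesis by simp
    qed
    then have "{p :: bool \<times> bool. fst p = snd p} \<in> sets borel" by (rule borel_open)
    from measurable_sets[OF * this] show ?thesis
      by (simp add: vimage_def Int_def conj_commute)
  qed
  have "{\<omega> \<in> space path_space. freezing_time x \<omega> < \<infinity>} =
    (\<Union>n::nat. space path_space \<inter> (\<Inter>q\<in>{q::rat. real n \<le> of_rat q}.
       {\<omega> \<in> space path_space. \<omega> (of_rat q) x = \<omega> (real n) x}))"
    (is "?A = ?B")
  proof (intro set_eqI)
    fix \<omega>
    show "\<omega> \<in> ?A \<longleftrightarrow> \<omega> \<in> ?B"
    proof (cases "\<omega> \<in> space path_space")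
      case True
      then have "cadlag \<omega>" by (simp add: space_path_space)
      note * = trans[OF freezing_time_finite_iff[of x \<omega>] ev[OF this]]
      show ?thesis unfolding mem_Collect_eq * using True by simp
    qed simp
  qed
  also have "\<dots> \<in> sets path_space"
  proof (intro sets.countable_UN sets.top image_subsetI)
    fix n :: nat
    have "{q::rat. real n \<le> of_rat q} \<noteq> {}"
      by (metis (mono_tags) empty_iff mem_Collect_eq of_rat_of_nat_eq order_refl)
    moreover have "{\<omega> \<in> space (path_space :: (real \<Rightarrow> config) measure). \<omega> (of_rat q) x = \<omega> (real n) x} \<in> sets path_space"
      if "real n \<le> of_rat q" for q :: rat
      by (intro m order_trans[OF of_nat_0_le_iff that] of_nat_0_le_iff)
    ultimately show "space path_space \<inter> (\<Inter>q\<in>{q::rat. real n \<le> of_rat q}.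
       {\<omega> \<in> space (path_space :: (real \<Rightarrow> config) measure). \<omega> (of_rat q) x = \<omega> (real n) x}) \<in> sets path_space"
      by (intro sets.Int sets.top sets.countable_INT') auto
  qed
  finally show ?thesis .
qed

end

theory Submission
  imports Defs
begin

text \<open>
  A pair of adjacent holes is never created, so such a pair blocks all current until it disappears,
  and sites to its right see only the particles that started there. For \<open>\<rho> < 1/2\<close> the walk with
  steps \<open>2 \<eta>(x) - 1\<close>, read leftwards from the origin, drifts to \<open>- \<infinity>\<close>; left of its maximum every
  interval ending at a suitable site \<open>x\<close> has no majority of particles, and no particle ever passes
  \<open>x\<close>, provided that the inflow at a far left boundary is sublinear. After that, the finitely many
  particles between \<open>x\<close> and the origin can jump only finitely often. For \<open>\<rho> \<ge> 1/2\<close> the walk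
  is unbounded above, so if the origin froze, some interval left of it would keep a majority of
  particles forever. It would freeze as well and contain two adjacent particles; as an enabled jump
  cannot stay enabled forever, everything to their right would be filled, which contradicts the
  finiteness of the current.

  The process is observed along dyadic grids. The generator controls the transition over a time step
  \<open>t\<close> in a finite window up to \<open>o(t)\<close>, so along a sufficiently fine grid the window sees, with
  probability close to 1, only single legal jumps.
\<close>

text \<open>The law is accessible only through its semigroup, and on the infinite lattice infinitely
  many particles may jump in any time interval, so there is no first jump and no list of jumps to
  follow. All dynamics is therefore expressed by deterministic statements about a finite window
  observed on a finite grid. A single grid is legal only with probability close to 1. Fatou's
  inequality for sets, P(limsup A_m) >= limsup P(A_m), converts such bounds into events that occur
  for infinitely many m, whatever the dependence between the grids. This is why the pathwise lemmas
  assume their hypotheses frequently in m. What they conclude about particular dyadic times is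
  independent of m, because the grids are nested and eventually contain any given dyadic time. The
  critical density 1/2 falls on the side without freezing because the symmetric walk, although
  driftless, is still unbounded above.\<close>

section \<open>Window dynamics\<close>

text \<open>
  From \<open>\<eta>\<close> to \<open>\<xi>\<close>, the window \<open>W\<close> sees what a legal jump from \<open>x\<close> to \<open>x + 1\<close> looks like on
  \<open>W\<close>; nothing happens if \<open>x\<close> is far from \<open>W\<close>.
\<close>
definition local_jump :: "int set \<Rightarrow> config \<Rightarrow> config \<Rightarrow> bool" where
  "local_jump W \<eta> \<xi> \<longleftrightarrow> (\<exists>x. \<forall>y\<in>W. (y = x - 1 \<longrightarrow> \<eta> y) \<and> (y = x \<longrightarrow> \<eta> y \<and> \<not> \<xi> y) \<and>
     (y = x + 1 \<longrightarrow> \<not> \<eta> y \<and> \<xi> y) \<and> (y \<noteq> x \<and> y \<noteq> x + 1 \<longrightarrow> \<xi> y = \<eta> y))"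

text \<open>Constant \<open>\<phi>\<close> counts particles and yields the conservation law. Linear
  \<open>\<phi>\<close> changes by one unit at each interior jump and yields monotone
  quantities.\<close>

definition weight :: "(int \<Rightarrow> int) \<Rightarrow> int \<Rightarrow> int \<Rightarrow> config \<Rightarrow> int" where
  "weight \<phi> p q \<eta> = (\<Sum>i\<in>{p..q}. of_bool (\<eta> i) * \<phi> i)"

definition excess :: "int \<Rightarrow> int \<Rightarrow> config \<Rightarrow> int" where
  "excess p q \<eta> = (\<Sum>i\<in>{p..q}. if \<eta> i then 1 else - 1)"

text \<open>Inside the window of legal steps a hole at \<open>y\<close> is filled only from
  \<open>y - 1\<close>, so this is the integrated current from \<open>y - 1\<close> to
  \<open>y\<close> as seen by the grid.\<close>

definition arrivals :: "nat \<Rightarrow> (nat \<Rightarrow> config) \<Rightarrow> int \<Rightarrow> nat" where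
  "arrivals n c y = card {i. i < n \<and> \<not> c i y \<and> c (Suc i) y}"

section \<open>Currents and conservation of particles in an interval\<close>

lemma arrivals_0 [simp]: "arrivals 0 c y = 0"
  by (simp add: arrivals_def)

lemma arrivals_Suc:
  "arrivals (Suc n) c y = arrivals n c y + of_bool (\<not> c n y \<and> c (Suc n) y)"
proof -
  have "{i. i < Suc n \<and> \<not> c i y \<and> c (Suc i) y} =
      {i. i < n \<and> \<not> c i y \<and> c (Suc i) y} \<union> (if \<not> c n y \<and> c (Suc n) y then {n} else {})"
    by (auto simp: less_Suc_eq)
  then show ?thesis by (simp add: arrivals_def)
qed

lemma arrivals_mono: "m \<le> n \<Longrightarrow> arrivals m c y \<le> arrivals n c y"
  unfolding arrivals_def by (intro card_mono) auto

lemma arrivals_eq_0: "(\<And>i. i < n \<Longrightarrow> c i y \<or> \<not> c (Suc i) y) \<Longrightarrow> arrivals n c y = 0"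
  unfolding arrivals_def by (auto simp: card_eq_0_iff)

lemma excess_eq_weight: "p \<le> q + 1 \<Longrightarrow> excess p q \<eta> = 2 * weight (\<lambda>_. 1) p q \<eta> - (q - p + 1)"
proof -
  assume "p \<le> q + 1"
  have "excess p q \<eta> = (\<Sum>i\<in>{p..q}. 2 * (of_bool (\<eta> i) * 1) - 1)"
    unfolding excess_def by (intro sum.cong) auto
  then show ?thesis
    using \<open>p \<le> q + 1\<close> by (simp add: weight_def sum_subtractf sum_distrib_left)
qed

lemma weight_jump:
  assumes jump: "\<forall>y\<in>W. (y = x \<longrightarrow> \<eta> y \<and> \<not> \<xi> y) \<and> (y = x + 1 \<longrightarrow> \<not> \<eta> y \<and> \<xi> y) \<and>
      (y \<noteq> x \<and> y \<noteq> x + 1 \<longrightarrow> \<xi> y = \<eta> y)"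
    and W: "{p..q} \<subseteq> W"
  shows "weight \<phi> p q \<xi> = weight \<phi> p q \<eta> + (if x + 1 \<in> {p..q} then \<phi> (x + 1) else 0)
     - (if x \<in> {p..q} then \<phi> x else 0)"
proof -
  have "weight \<phi> p q \<xi> =
      (\<Sum>i\<in>{p..q}. of_bool (\<eta> i) * \<phi> i + (if i = x + 1 then \<phi> i else 0) - (if i = x then \<phi> i else 0))"
    unfolding weight_def
  proof (rule sum.cong[OF refl])
    fix i assume "i \<in> {p..q}"
    then show "of_bool (\<xi> i) * \<phi> i =
        of_bool (\<eta> i) * \<phi> i + (if i = x + 1 then \<phi> i else 0) - (if i = x then \<phi> i else 0)"
      using jump[rule_format, of i] W by (cases "i = x"; cases "i = x + 1") auto
  qed
  then show ?thesis
    by (simp add: weight_def sum.distrib sum_subtractf)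
qed

text \<open>Only the two boundary currents matter. An entering particle replaces a hole, hence the
  factor 2. A departure from \<open>q\<close> is read off as an arrival at \<open>q + 1\<close>, so
  that both terms are of the kind counted by \<open>arrivals\<close>; this is why the window
  contains \<open>q + 1\<close>.\<close>

lemma excess_local_jump:
  assumes "local_jump W \<eta> \<xi>" and W: "{p..q + 1} \<subseteq> W" and pq: "p \<le> q + 1"
  shows "excess p q \<xi> = excess p q \<eta> + 2 * of_bool (\<not> \<eta> p \<and> \<xi> p) - 2 * of_bool (\<not> \<eta> (q + 1) \<and> \<xi> (q + 1))"
proof -
  obtain x where x: "\<forall>y\<in>W. (y = x - 1 \<longrightarrow> \<eta> y) \<and> (y = x \<longrightarrow> \<eta> y \<and> \<not> \<xi> y) \<and>
     (y = x + 1 \<longrightarrow> \<not> \<eta> y \<and> \<xi> y) \<and> (y \<noteq> x \<and> y \<noteq> x + 1 \<longrightarrow> \<xi> y = \<eta> y)"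
    using assms(1) unfolding local_jump_def by blast
  have up: "\<not> \<eta> y \<and> \<xi> y \<longleftrightarrow> y = x + 1" if "y \<in> {p, q + 1}" for y
  proof -
    have "y \<in> W" using that W pq by auto
    then show ?thesis using x[rule_format, of y] by auto
  qed
  have "{p..q} \<subseteq> W" using W by auto
  then have "weight (\<lambda>_. 1) p q \<xi> = weight (\<lambda>_. 1) p q \<eta> + (if x + 1 \<in> {p..q} then 1 else 0)
     - (if x \<in> {p..q} then 1 else 0)"
    using x by (intro weight_jump[where W = W]) auto
  then show ?thesis
    using pq by (auto simp: excess_eq_weight up)
qed

lemma excess_flux:
  assumes good: "\<And>i. i < n \<Longrightarrow> local_jump W (c i) (c (Suc i))"
    and W: "{p..q + 1} \<subseteq> W" and pq: "p \<le> q + 1"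
  shows "excess p q (c n) = excess p q (c 0) + 2 * int (arrivals n c p) - 2 * int (arrivals n c (q + 1))"
  using good
proof (induction n)
  case (Suc n)
  have "excess p q (c (Suc n)) = excess p q (c n) + 2 * of_bool (\<not> c n p \<and> c (Suc n) p)
     - 2 * of_bool (\<not> c n (q + 1) \<and> c (Suc n) (q + 1))"
    by (intro excess_local_jump[OF Suc.prems W pq]) simp
  then show ?case using Suc by (simp add: arrivals_Suc)
qed simp

text \<open>After a jump from \<open>x\<close>, the emptied site has occupied neighbours on both
  sides: \<open>x + 1\<close> was just filled, and \<open>x - 1\<close> is occupied by the
  facilitation rule. So it belongs to no pair of adjacent holes, and any such pair was there
  before.\<close>

lemma local_jump_00:
  assumes "local_jump W \<eta> \<xi>" "z \<in> W" "z + 1 \<in> W" "\<not> \<xi> z" "\<not> \<xi> (z + 1)"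
  shows "\<not> \<eta> z \<and> \<not> \<eta> (z + 1)"
proof -
  obtain x where x: "\<forall>y\<in>W. (y = x - 1 \<longrightarrow> \<eta> y) \<and> (y = x \<longrightarrow> \<eta> y \<and> \<not> \<xi> y) \<and>
     (y = x + 1 \<longrightarrow> \<not> \<eta> y \<and> \<xi> y) \<and> (y \<noteq> x \<and> y \<noteq> x + 1 \<longrightarrow> \<xi> y = \<eta> y)"
    using assms(1) unfolding local_jump_def by blast
  show ?thesis
    using x[rule_format, OF assms(2)] x[rule_format, OF assms(3)] assms(4,5) by fastforce
qed

text \<open>Every hole is followed by a particle of its own, and because \<open>x - 1\<close> and
  \<open>x\<close> are both occupied, the particle at \<open>x\<close> is left over.\<close>

lemma excess_pos_if_no_00:
  assumes x: "\<eta> (x - 1)" "\<eta> x" and "z \<le> x - 1"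
    and no: "\<And>y. z \<le> y \<Longrightarrow> y < x \<Longrightarrow> \<eta> y \<or> \<eta> (y + 1)"
  shows "1 \<le> excess z x \<eta>"
proof -
  have split: "excess y x \<eta> = (if \<eta> y then 1 else - 1) + excess (y + 1) x \<eta>" if "y \<le> x" for y
  proof -
    have "{y..x} = insert y {y + 1..x}" using that by auto
    then show ?thesis by (simp add: excess_def)
  qed
  \<comment> \<open>The induction needs the stronger value 2 at an occupied left end: a hole can
    then be prepended at the cost of 1, and a particle prepended to a hole restores 2.\<close>
  have "(if \<eta> z then 2 else 1) \<le> excess z x \<eta>"
    using \<open>z \<le> x - 1\<close> no
  proof (induction z rule: int_le_induct)
    case base
    have "excess (x - 1) x \<eta> = 2"
      using split[of "x - 1"] split[of x] x by (simp add: excess_def)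
    then show ?case by simp
  next
    case (step z)
    then have "(if \<eta> z then 2 else 1) \<le> excess z x \<eta>" by auto
    moreover have "\<eta> (z - 1) \<or> \<eta> z" using step.prems[of "z - 1"] step.hyps by auto
    ultimately show ?case using split[of "z - 1"] step.hyps by (auto split: if_splits)
  qed
  then show ?thesis by (auto split: if_splits)
qed

text \<open>
  At the first passage from \<open>x\<close> to \<open>x + 1\<close> the sites \<open>x - 1\<close>, \<open>x\<close> are occupied. Adjacent holes are
  never created, so the rightmost pair of them left of \<open>x\<close> has blocked all current since time 0,
  and the particles beyond that pair already were in the majority at time 0.
\<close>
lemma no_passage:
  assumes good: "\<And>i. i < n \<Longrightarrow> local_jump {a..b} (c i) (c (Suc i))"
    and ax: "a < x" and xb: "x + 1 \<le> b"
    and neg: "\<And>z. a < z \<Longrightarrow> z \<le> x \<Longrightarrow> excess z x (c 0) \<le> 0"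
    and left: "excess a x (c 0) + 2 * int (arrivals n c a) \<le> 0"
    and "j < n"
  shows "c j (x + 1) \<or> \<not> c (Suc j) (x + 1)"
  using \<open>j < n\<close>
proof (induction j rule: less_induct)
  case (less j)
  show ?case
  proof (rule ccontr)
    assume up: "\<not> (c j (x + 1) \<or> \<not> c (Suc j) (x + 1))"
    obtain x' where x': "\<forall>y\<in>{a..b}. (y = x' - 1 \<longrightarrow> c j y) \<and> (y = x' \<longrightarrow> c j y \<and> \<not> c (Suc j) y) \<and>
       (y = x' + 1 \<longrightarrow> \<not> c j y \<and> c (Suc j) y) \<and> (y \<noteq> x' \<and> y \<noteq> x' + 1 \<longrightarrow> c (Suc j) y = c j y)"
      using good[OF less.prems] unfolding local_jump_def by blast
    have "x' = x" using x'[rule_format, of "x + 1"] up ax xb by force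
    then have occ: "c j x" "c j (x - 1)"
      using x'[rule_format, of x] x'[rule_format, of "x - 1"] ax xb by auto
    have flux: "excess p x (c j) = excess p x (c 0) + 2 * int (arrivals j c p)" if "a \<le> p" "p \<le> x" for p
    proof -
      have "arrivals j c (x + 1) = 0" using less by (intro arrivals_eq_0) auto
      then show ?thesis using excess_flux[of j "{a..b}" c p x] good less.prems that xb by auto
    qed
    show False
    proof (cases "\<exists>z. a \<le> z \<and> z < x \<and> \<not> c j z \<and> \<not> c j (z + 1)")
      case True
      define Z where "Z = {z. a \<le> z \<and> z < x \<and> \<not> c j z \<and> \<not> c j (z + 1)}"
      have "finite Z" by (rule finite_subset[of _ "{a..x}"]) (auto simp: Z_def)
      moreover have "Z \<noteq> {}" using True by (auto simp: Z_def)
      ultimately have z: "Max Z \<in> Z" "\<And>y. y \<in> Z \<Longrightarrow> y \<le> Max Z" by auto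
      define z where "z = Max Z"
      have za: "a \<le> z" "z < x" "\<not> c j z" "\<not> c j (z + 1)" using z(1) by (auto simp: Z_def z_def)
      have zx: "z + 1 \<le> x - 1" using za occ by (cases "z = x - 1"; cases "z + 1 = x - 1") auto
      have "\<not> c i z \<and> \<not> c i (z + 1)" if "i \<le> j" for i
        using that
      proof (induction rule: inc_induct)
        case (step i)
        then show ?case
          using local_jump_00[OF good[of i], of z] less.prems za xb by auto
      qed (use za in auto)
      then have "arrivals j c (z + 1) = 0" by (intro arrivals_eq_0) auto
      moreover have "1 \<le> excess (z + 1) x (c j)"
      proof (rule excess_pos_if_no_00[of _ _ "z + 1"])
        fix y assume "z + 1 \<le> y" "y < x"
        then show "c j y \<or> c j (y + 1)" using z(2)[of y] za unfolding Z_def z_def by fastforce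
      qed (use occ zx in auto)
      ultimately show False using flux[of "z + 1"] neg[of "z + 1"] za by auto
    next
      case False
      \<comment> \<open>Without any pair of holes the surplus extends to the window boundary
        \<open>a\<close>, where particles may have entered; \<open>left\<close> was assumed with
        this inflow included.\<close>
      then have "1 \<le> excess a x (c j)" using occ ax by (intro excess_pos_if_no_00) auto
      then show False using flux[of a] left arrivals_mono[of j n c a] less.prems ax by auto
    qed
  qed
qed

text \<open>The weight of a site is the number of jumps that take a particle from there past
  \<open>q\<close>. Without inflow each jump from a site of the interval lowers the total by exactly
  1, so equality means that nothing moved.\<close>

lemma weight_le_of_no_arrival:
  assumes "local_jump W \<eta> \<xi>" and W: "{p..q} \<subseteq> W" and pq: "p \<le> q" and no: "\<eta> p \<or> \<not> \<xi> p"
  shows "weight (\<lambda>i. q + 1 - i) p q \<xi> \<le> weight (\<lambda>i. q + 1 - i) p q \<eta>"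
    and "weight (\<lambda>i. q + 1 - i) p q \<xi> = weight (\<lambda>i. q + 1 - i) p q \<eta> \<Longrightarrow> y \<in> {p..q} \<Longrightarrow> \<xi> y = \<eta> y"
proof -
  obtain x where x: "\<forall>y\<in>W. (y = x - 1 \<longrightarrow> \<eta> y) \<and> (y = x \<longrightarrow> \<eta> y \<and> \<not> \<xi> y) \<and>
     (y = x + 1 \<longrightarrow> \<not> \<eta> y \<and> \<xi> y) \<and> (y \<noteq> x \<and> y \<noteq> x + 1 \<longrightarrow> \<xi> y = \<eta> y)"
    using assms(1) unfolding local_jump_def by blast
  have "p \<in> W" using W pq by auto
  then have "x + 1 \<noteq> p" using x[rule_format, of p] no by auto
  moreover have "weight (\<lambda>i. q + 1 - i) p q \<xi> = weight (\<lambda>i. q + 1 - i) p q \<eta> +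
      (if x + 1 \<in> {p..q} then q + 1 - (x + 1) else 0) - (if x \<in> {p..q} then q + 1 - x else 0)"
    using x W by (intro weight_jump[where W = W]) auto
  ultimately have *: "weight (\<lambda>i. q + 1 - i) p q \<xi> = weight (\<lambda>i. q + 1 - i) p q \<eta> - of_bool (x \<in> {p..q})"
    by auto
  then show "weight (\<lambda>i. q + 1 - i) p q \<xi> \<le> weight (\<lambda>i. q + 1 - i) p q \<eta>" by simp
  assume "weight (\<lambda>i. q + 1 - i) p q \<xi> = weight (\<lambda>i. q + 1 - i) p q \<eta>" and y: "y \<in> {p..q}"
  then have "x \<notin> {p..q}" using * by simp
  then have "y \<noteq> x \<and> y \<noteq> x + 1" using y \<open>x + 1 \<noteq> p\<close> unfolding atLeastAtMost_iff by presburger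
  moreover have "y \<in> W" using y W by auto
  ultimately show "\<xi> y = \<eta> y" using x by blast
qed

text \<open>Mirror image: the weight of a site counts the jumps made since just before entry at
  \<open>p\<close>. With the exit closed, each jump onto a site of the interval, from inside or from
  the left, adds exactly 1.\<close>

lemma weight_ge_of_no_departure:
  assumes "local_jump W \<eta> \<xi>" and W: "{p..q + 1} \<subseteq> W" and pq: "p \<le> q" and no: "\<eta> (q + 1) \<or> \<not> \<xi> (q + 1)"
  shows "weight (\<lambda>i. i - p + 1) p q \<eta> \<le> weight (\<lambda>i. i - p + 1) p q \<xi>"
    and "weight (\<lambda>i. i - p + 1) p q \<eta> = weight (\<lambda>i. i - p + 1) p q \<xi> \<Longrightarrow> y \<in> {p..q} \<Longrightarrow> \<xi> y = \<eta> y"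
proof -
  obtain x where x: "\<forall>y\<in>W. (y = x - 1 \<longrightarrow> \<eta> y) \<and> (y = x \<longrightarrow> \<eta> y \<and> \<not> \<xi> y) \<and>
     (y = x + 1 \<longrightarrow> \<not> \<eta> y \<and> \<xi> y) \<and> (y \<noteq> x \<and> y \<noteq> x + 1 \<longrightarrow> \<xi> y = \<eta> y)"
    using assms(1) unfolding local_jump_def by blast
  have "q + 1 \<in> W" using W pq by auto
  then have xq: "x \<noteq> q" using x[rule_format, of "q + 1"] no by auto
  moreover have "weight (\<lambda>i. i - p + 1) p q \<xi> = weight (\<lambda>i. i - p + 1) p q \<eta> +
      (if x + 1 \<in> {p..q} then x + 1 - p + 1 else 0) - (if x \<in> {p..q} then x - p + 1 else 0)"
    using x W by (intro weight_jump[where W = W]) auto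
  ultimately have *: "weight (\<lambda>i. i - p + 1) p q \<xi> = weight (\<lambda>i. i - p + 1) p q \<eta> + of_bool (x + 1 \<in> {p..q})"
    using pq by auto
  then show "weight (\<lambda>i. i - p + 1) p q \<eta> \<le> weight (\<lambda>i. i - p + 1) p q \<xi>" by simp
  assume "weight (\<lambda>i. i - p + 1) p q \<eta> = weight (\<lambda>i. i - p + 1) p q \<xi>" and y: "y \<in> {p..q}"
  then have "x + 1 \<notin> {p..q}" using * by simp
  then have "y \<noteq> x \<and> y \<noteq> x + 1" using y xq unfolding atLeastAtMost_iff by presburger
  moreover have "y \<in> W" using y W by auto
  ultimately show "\<xi> y = \<eta> y" using x by blast
qed

section \<open>Paths observed along dyadic grids\<close>

definition sample :: "nat \<Rightarrow> (real \<Rightarrow> config) \<Rightarrow> nat \<Rightarrow> config" where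
  "sample e \<omega> j = \<omega> (real j / 2 ^ e)"

definition legal :: "nat \<Rightarrow> nat \<Rightarrow> nat \<Rightarrow> (real \<Rightarrow> config) \<Rightarrow> bool" where
  "legal T e w \<omega> \<longleftrightarrow>
     (\<forall>j<T * 2 ^ e. local_jump {- int w..int w} (sample e \<omega> j) (sample e \<omega> (Suc j)))"

lemma sample_refine:
  assumes "e \<le> K"
  shows "sample K \<omega> (i * 2 ^ (K - e)) = sample e \<omega> i"
proof -
  have "(2::real) ^ K = 2 ^ (K - e) * 2 ^ e" using assms by (simp flip: power_add)
  then show ?thesis by (simp add: sample_def)
qed

lemma sample_nat: "sample K \<omega> (T * 2 ^ K) = \<omega> (real T)"
  by (simp add: sample_def)

lemma dyadic_le_iff:
  assumes "e \<le> K" "e' \<le> K"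
  shows "i * 2 ^ (K - e) \<le> i' * 2 ^ (K - e') \<longleftrightarrow> real i / 2 ^ e \<le> real i' / 2 ^ e'"
proof -
  have *: "real i / 2 ^ e = real (i * 2 ^ (K - e)) / 2 ^ K" if "e \<le> K" for i e
  proof -
    have "(2::real) ^ K = 2 ^ (K - e) * 2 ^ e" using that by (simp flip: power_add)
    then show ?thesis by simp
  qed
  show ?thesis
    unfolding *[OF assms(1)] *[OF assms(2)] by (simp add: divide_le_cancel del: of_nat_mult)
qed

lemma frequently_large:
  assumes "\<exists>\<^sub>F m in sequentially. Q m"
  obtains m where "Q m" "(n::nat) \<le> m"
  using frequently_eventually_frequently[OF assms eventually_ge_at_top[of n]]
  by (auto dest: frequently_ex)

text \<open>Mesh and horizon both improve with \<open>m\<close>, so any two given dyadic times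
  eventually lie on the grid of \<open>m\<close>. Infinitely many good indices \<open>m\<close> thus
  suffice to reach them.\<close>

lemma frequently_large_grid:
  fixes k :: "nat \<Rightarrow> nat"
  assumes k: "\<And>m. m \<le> k m" and freq: "\<exists>\<^sub>F m in sequentially. Q m"
  obtains m where "Q m" "n \<le> m" "e \<le> k m" "e' \<le> k m" "real i / 2 ^ e \<le> real m"
proof -
  obtain N :: nat where N: "real i / 2 ^ e \<le> real N" using real_arch_simple by blast
  obtain m where m: "Q m" "Max {n, e, e', N} \<le> m" by (rule frequently_large[OF freq])
  then have "real N \<le> real m" by simp
  then have "real i / 2 ^ e \<le> real m" using N by linarith
  then show thesis using m that k[of m] by simp
qed

lemma grid_index_less:
  assumes "e \<le> K" "real i / 2 ^ e \<le> real m"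
  shows "i * 2 ^ (K - e) \<le> m * 2 ^ K"
  using dyadic_le_iff[OF assms(1), of 0 i m] assms(2) by simp

lemma int_bounded_above_attains_max:
  fixes f :: "'b \<Rightarrow> int"
  assumes "X \<noteq> {}" "\<And>x. x \<in> X \<Longrightarrow> f x \<le> B"
  obtains x where "x \<in> X" "\<And>y. y \<in> X \<Longrightarrow> f y \<le> f x"
proof -
  obtain x0 where "x0 \<in> X" using assms by blast
  then obtain x where "x \<in> X" "\<And>y. y \<in> X \<Longrightarrow> nat (B - f x) \<le> nat (B - f y)"
    using ex_has_least_nat[of "\<lambda>x. x \<in> X" x0 "\<lambda>x. nat (B - f x)"] by blast
  moreover have "f y \<le> f x" if "y \<in> X" for y
    using calculation(2)[OF that] assms(2)[OF that] assms(2)[OF calculation(1)] by linarith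
  ultimately show thesis using that by blast
qed

text \<open>A bounded nondecreasing integer quantity moves only finitely often, and \<open>g\<close>
  may move only together with \<open>f\<close>. The conclusion covers all dyadic times, although
  each hypothesis speaks of one grid.\<close>

lemma monotone_observable_stabilizes:
  fixes k :: "nat \<Rightarrow> nat" and f :: "config \<Rightarrow> int" and g :: "config \<Rightarrow> 'b"
  assumes k: "\<And>m. m \<le> k m"
    and step: "\<exists>\<^sub>F m in sequentially. \<forall>j. T * 2 ^ k m \<le> j \<and> j < m * 2 ^ k m \<longrightarrow>
      f (sample (k m) \<omega> j) \<le> f (sample (k m) \<omega> (Suc j)) \<and>
      (f (sample (k m) \<omega> j) = f (sample (k m) \<omega> (Suc j)) \<longrightarrow>
        g (sample (k m) \<omega> (Suc j)) = g (sample (k m) \<omega> j))"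
    and bound: "\<And>\<eta>. f \<eta> \<le> B"
  obtains T' where "T \<le> T'" "\<forall>i e. real T' \<le> real i / 2 ^ e \<longrightarrow> g (sample e \<omega> i) = g (\<omega> (real T'))"
proof -
  \<comment> \<open>Two dyadic times from different grids are compared on one good grid that
    contains both.\<close>
  have mono: "f (sample e \<omega> i) \<le> f (sample e' \<omega> i') \<and>
      (f (sample e \<omega> i) = f (sample e' \<omega> i') \<longrightarrow> g (sample e' \<omega> i') = g (sample e \<omega> i))"
    if le: "real T \<le> real i / 2 ^ e" "real i / 2 ^ e \<le> real i' / 2 ^ e'" for i e i' e'
  proof -
    obtain m where m: "\<forall>j. T * 2 ^ k m \<le> j \<and> j < m * 2 ^ k m \<longrightarrow>
      f (sample (k m) \<omega> j) \<le> f (sample (k m) \<omega> (Suc j)) \<and>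
      (f (sample (k m) \<omega> j) = f (sample (k m) \<omega> (Suc j)) \<longrightarrow>
        g (sample (k m) \<omega> (Suc j)) = g (sample (k m) \<omega> j))"
      and e: "e' \<le> k m" "e \<le> k m" and mt: "real i' / 2 ^ e' \<le> real m"
      by (rule frequently_large_grid[OF k step, where e = e' and i = i'])
    define a where "a = i * 2 ^ (k m - e)"
    define b where "b = i' * 2 ^ (k m - e')"
    have "a \<le> b" unfolding a_def b_def using dyadic_le_iff[OF e(2,1)] le by blast
    moreover have "b \<le> m * 2 ^ k m" unfolding b_def by (rule grid_index_less[OF e(1) mt])
    moreover have "T * 2 ^ k m \<le> a"
      using dyadic_le_iff[of 0 "k m" e T i] e le by (simp add: a_def)
    ultimately have "f (sample (k m) \<omega> a) \<le> f (sample (k m) \<omega> b) \<and>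
        (f (sample (k m) \<omega> a) = f (sample (k m) \<omega> b) \<longrightarrow> g (sample (k m) \<omega> b) = g (sample (k m) \<omega> a))"
    proof (induction b rule: dec_induct)
      case (step b)
      then show ?case using m[rule_format, of b] by (smt (verit) Suc_le_lessD Suc_leD le_trans)
    qed simp
    then show ?thesis by (simp add: a_def b_def sample_refine e)
  qed
  \<comment> \<open>The maximum of \<open>f\<close> over all dyadic times from \<open>T\<close> on
    is attained; after that time \<open>f\<close>, and with it \<open>g\<close>, is
    constant.\<close>
  define X where "X = {(i, e). real T \<le> real i / 2 ^ e}"
  have "(T, 0) \<in> X" by (simp add: X_def)
  then obtain p where p: "p \<in> X" "\<And>y. y \<in> X \<Longrightarrow> f (sample (snd y) \<omega> (fst y)) \<le> f (sample (snd p) \<omega> (fst p))"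
    using int_bounded_above_attains_max[of X "\<lambda>p. f (sample (snd p) \<omega> (fst p))" B] bound by blast
  obtain i0 e0 where p_eq: "p = (i0, e0)" by (cases p)
  obtain T' :: nat where T': "max (real i0 / 2 ^ e0) (real T) \<le> real T'" using real_arch_simple by blast
  show thesis
  proof (rule that[of T'], use T' in simp, intro allI impI)
    fix i e assume ie: "real T' \<le> real i / 2 ^ e"
    have const: "g (sample e \<omega> i) = g (sample e0 \<omega> i0)" if "real T' \<le> real i / 2 ^ e" for i e
    proof -
      have "f (sample e \<omega> i) \<le> f (sample e0 \<omega> i0)"
        using p(2)[of "(i, e)"] that T' by (simp add: X_def p_eq)
      moreover have "real T \<le> real i0 / 2 ^ e0" using p(1) by (simp add: X_def p_eq)
      ultimately show ?thesis using mono[of i0 e0 i e] that T' by auto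
    qed
    show "g (sample e \<omega> i) = g (\<omega> (real T'))"
      using const[OF ie] const[of T' 0] by (simp add: sample_def)
  qed
qed

section \<open>Freezing under negative drift\<close>

lemma excess_split: "p \<le> q + 1 \<Longrightarrow> q \<le> r \<Longrightarrow> excess p r \<eta> = excess p q \<eta> + excess (q + 1) r \<eta>"
proof -
  assume "p \<le> q + 1" "q \<le> r"
  then have "{p..r} = {p..q} \<union> {q + 1..r}" by auto
  then show ?thesis unfolding excess_def by (simp add: sum.union_disjoint)
qed

text \<open>The drift \<open>2 * c\<close> is spent in two halves: one absorbs the fixed excess of
  the sites between the blocking site and the origin, the other pays for the particles entering at
  \<open>- int (w m)\<close>, each of which raises the excess by 2.\<close>

lemma eventually_frozen:
  assumes k: "\<And>m. m \<le> k m" and w: "\<And>m. m \<le> w m" and "0 < c"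
    and freq: "\<exists>\<^sub>F m in sequentially. legal m (k m) (w m) \<omega> \<and>
      2 * real (arrivals (m * 2 ^ k m) (sample (k m) \<omega>) (- int (w m))) \<le> c * real (w m)"
    and walk: "\<forall>\<^sub>F n in sequentially. real_of_int (excess (- int n) 0 (\<omega> 0)) \<le> - 2 * c * real n"
  shows "\<exists>T. \<forall>i e. real T \<le> real i / 2 ^ e \<longrightarrow> sample e \<omega> i 0 = \<omega> (real T) 0"
proof -
  define F where "F n = excess (- int n) 0 (\<omega> 0)" for n
  obtain N where N: "\<And>n. n \<ge> N \<Longrightarrow> real_of_int (F n) \<le> - 2 * c * real n"
    using walk unfolding F_def eventually_sequentially by blast
  have F_le: "F n \<le> int N + 1" for n
  proof (cases "n \<ge> N")
    case True
    moreover have "0 \<le> c * real n" using \<open>0 < c\<close> by simp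
    ultimately have "real_of_int (F n) \<le> 0" using N[of n] by linarith
    then show ?thesis by simp
  next
    case False
    have "F n \<le> (\<Sum>i\<in>{- int n..0}. 1)" unfolding F_def excess_def by (intro sum_mono) auto
    then show ?thesis using False by simp
  qed
  obtain n where "n \<in> UNIV" and "\<And>n'. n' \<in> UNIV \<Longrightarrow> F n' \<le> F n"
    by (rule int_bounded_above_attains_max[of UNIV F "int N + 1"]) (use F_le in auto)
  then have n: "F n' \<le> F n" for n' by simp
  \<comment> \<open>The site just beyond an interval that maximises \<open>F\<close>. For
    \<open>z \<le> x\<close> the excess of \<open>{z..x}\<close> is a value of \<open>F\<close>
    minus the maximum \<open>F n\<close>, hence not positive.\<close>
  define x where "x = - int n - 1"
  have neg: "excess z x (\<omega> 0) \<le> 0" if "z \<le> x" for z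
  proof -
    have "excess z 0 (\<omega> 0) = excess z x (\<omega> 0) + excess (x + 1) 0 (\<omega> 0)"
      using that by (intro excess_split) (auto simp: x_def)
    moreover have "excess z 0 (\<omega> 0) = F (nat (- z))" using that by (simp add: F_def x_def)
    ultimately show ?thesis using n[of "nat (- z)"] by (simp add: F_def x_def)
  qed
  obtain M :: nat where M: "\<bar>real_of_int (F n)\<bar> / c \<le> real M" using real_arch_simple by blast
  have "\<exists>\<^sub>F m in sequentially. legal m (k m) (w m) \<omega> \<and> n + 2 \<le> w m \<and>
      (\<forall>j<m * 2 ^ k m. sample (k m) \<omega> j (x + 1) \<or> \<not> sample (k m) \<omega> (Suc j) (x + 1))"
  proof (rule frequently_rev_mp[OF freq], rule eventually_mono[OF eventually_ge_at_top[of "N + M + n + 2"]], safe)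
    fix m assume m: "m \<ge> N + M + n + 2" and leg: "legal m (k m) (w m) \<omega>"
      and arr: "2 * real (arrivals (m * 2 ^ k m) (sample (k m) \<omega>) (- int (w m))) \<le> c * real (w m)"
    show wn: "n + 2 \<le> w m" using w[of m] m by simp
    fix j assume j: "j < m * 2 ^ k m" "\<not> sample (k m) \<omega> j (x + 1)" "sample (k m) \<omega> (Suc j) (x + 1)"
    have 0: "sample (k m) \<omega> 0 = \<omega> 0" by (simp add: sample_def)
    have "sample (k m) \<omega> j (x + 1) \<or> \<not> sample (k m) \<omega> (Suc j) (x + 1)"
    proof (rule no_passage[where c = "sample (k m) \<omega>" and x = x, OF _ _ _ _ _ j(1)])
      show "- int (w m) < x" "x + 1 \<le> int (w m)" using wn by (auto simp: x_def)
      show "excess z x (sample (k m) \<omega> 0) \<le> 0" if "z \<le> x" for z using neg[OF that] by (simp add: 0)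
      have split: "excess (- int (w m)) 0 (\<omega> 0) = excess (- int (w m)) x (\<omega> 0) + excess (x + 1) 0 (\<omega> 0)"
        using wn by (intro excess_split) (auto simp: x_def)
      have "real_of_int (F (w m)) \<le> - 2 * c * real (w m)" using N w[of m] m by simp
      moreover have "- real_of_int (F n) \<le> c * real (w m)"
      proof -
        have "- real_of_int (F n) \<le> c * real M" using M \<open>0 < c\<close> by (simp add: field_simps)
        also have "\<dots> \<le> c * real (w m)" using \<open>0 < c\<close> w[of m] m by simp
        finally show ?thesis .
      qed
      ultimately have "real_of_int (excess (- int (w m)) x (\<omega> 0)) \<le> - c * real (w m)"
        using split by (simp add: F_def x_def)
      then show "excess (- int (w m)) x (sample (k m) \<omega> 0)
          + 2 * int (arrivals (m * 2 ^ k m) (sample (k m) \<omega>) (- int (w m))) \<le> 0"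
        using arr unfolding 0 by linarith
    qed (use leg in \<open>auto simp: legal_def\<close>)
    then show False using j by blast
  qed
  \<comment> \<open>The sign turns the decreasing weight into the nondecreasing \<open>f\<close> of
    \<open>monotone_observable_stabilizes\<close>; \<open>0 + 1 - i\<close> is the instance
    \<open>q = 0\<close> of \<open>weight_le_of_no_arrival\<close>.\<close>
  then have step: "\<exists>\<^sub>F m in sequentially. \<forall>j. 0 * 2 ^ k m \<le> j \<and> j < m * 2 ^ k m \<longrightarrow>
      - weight (\<lambda>i. 0 + 1 - i) (x + 1) 0 (sample (k m) \<omega> j)
        \<le> - weight (\<lambda>i. 0 + 1 - i) (x + 1) 0 (sample (k m) \<omega> (Suc j)) \<and>
      (- weight (\<lambda>i. 0 + 1 - i) (x + 1) 0 (sample (k m) \<omega> j)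
        = - weight (\<lambda>i. 0 + 1 - i) (x + 1) 0 (sample (k m) \<omega> (Suc j)) \<longrightarrow>
        sample (k m) \<omega> (Suc j) 0 = sample (k m) \<omega> j 0)"
  proof (rule frequently_elim1, intro allI impI)
    fix m j assume m: "legal m (k m) (w m) \<omega> \<and> n + 2 \<le> w m \<and>
      (\<forall>j<m * 2 ^ k m. sample (k m) \<omega> j (x + 1) \<or> \<not> sample (k m) \<omega> (Suc j) (x + 1))"
      and j: "0 * 2 ^ k m \<le> j \<and> j < m * 2 ^ k m"
    have 1: "local_jump {- int (w m)..int (w m)} (sample (k m) \<omega> j) (sample (k m) \<omega> (Suc j))"
      using m j by (simp add: legal_def)
    have 2: "{x + 1..0} \<subseteq> {- int (w m)..int (w m)}" using m by (auto simp: x_def)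
    have 3: "x + 1 \<le> 0" by (simp add: x_def)
    have 4: "sample (k m) \<omega> j (x + 1) \<or> \<not> sample (k m) \<omega> (Suc j) (x + 1)" using m j by blast
    show "- weight (\<lambda>i. 0 + 1 - i) (x + 1) 0 (sample (k m) \<omega> j)
        \<le> - weight (\<lambda>i. 0 + 1 - i) (x + 1) 0 (sample (k m) \<omega> (Suc j)) \<and>
      (- weight (\<lambda>i. 0 + 1 - i) (x + 1) 0 (sample (k m) \<omega> j)
        = - weight (\<lambda>i. 0 + 1 - i) (x + 1) 0 (sample (k m) \<omega> (Suc j)) \<longrightarrow>
        sample (k m) \<omega> (Suc j) 0 = sample (k m) \<omega> j 0)"
      using weight_le_of_no_arrival(1)[OF 1 2 3 4] weight_le_of_no_arrival(2)[OF 1 2 3 4, of 0] 3 by auto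
  qed
  have bound: "- weight (\<lambda>i. 0 + 1 - i) (x + 1) 0 \<eta> \<le> 0" for \<eta>
    unfolding weight_def by (auto intro!: sum_nonneg)
  show ?thesis
    by (rule monotone_observable_stabilizes[where g = "\<lambda>\<eta>. \<eta> 0" and T = 0 and B = 0 and k = k and \<omega> = \<omega>
          and f = "\<lambda>\<eta>. - weight (\<lambda>i. 0 + 1 - i) (x + 1) 0 \<eta>"])
      (fact k step bound | rule exI, assumption)+
qed

section \<open>Persistence of a surplus and absence of freezing\<close>

lemma arrivals_eq_if_none_between:
  assumes "m \<le> n" and "\<And>i. m \<le> i \<Longrightarrow> i < n \<Longrightarrow> c i y \<or> \<not> c (Suc i) y"
  shows "arrivals n c y = arrivals m c y"
  using assms
proof (induction n rule: dec_induct)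
  case (step n)
  have "arrivals n c y = arrivals m c y" using step.prems by (intro step.IH) auto
  then show ?case using step.prems[of n] step.hyps by (simp add: arrivals_Suc)
qed simp

lemma excess_le_length: "p \<le> q + 1 \<Longrightarrow> excess p q \<eta> \<le> q - p + 1"
proof -
  assume "p \<le> q + 1"
  have "excess p q \<eta> \<le> (\<Sum>i\<in>{p..q}. 1)" unfolding excess_def by (intro sum_mono) auto
  then show ?thesis using \<open>p \<le> q + 1\<close> by simp
qed

lemma excess_full:
  assumes "p \<le> q + 1" and "\<And>y. p \<le> y \<Longrightarrow> y \<le> q \<Longrightarrow> \<eta> y"
  shows "excess p q \<eta> = q - p + 1"
proof -
  have "excess p q \<eta> = (\<Sum>i\<in>{p..q}. 1)" unfolding excess_def using assms(2) by (intro sum.cong) auto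
  then show ?thesis using assms(1) by simp
qed

text \<open>Otherwise every particle left of \<open>q\<close> would be followed by a hole of its
  own, leaving an excess of at most 1.\<close>

lemma adjacent_particles_if_excess:
  assumes "p \<le> q" and "2 \<le> excess p q \<eta>"
  obtains y where "p \<le> y" "y < q" "\<eta> y" "\<eta> (y + 1)"
proof -
  have "excess p q \<eta> \<le> (if \<eta> p then 1 else 0)"
    if no: "\<And>y. p \<le> y \<Longrightarrow> y < q \<Longrightarrow> \<not> (\<eta> y \<and> \<eta> (y + 1))"
    using \<open>p \<le> q\<close> no
  proof (induction p rule: int_le_induct)
    case base
    then show ?case by (simp add: excess_def)
  next
    case (step z)
    have "excess (z - 1) q \<eta> = excess (z - 1) (z - 1) \<eta> + excess z q \<eta>"
      using excess_split[of "z - 1" "z - 1" q \<eta>] step.hyps by simp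
    also have "excess (z - 1) (z - 1) \<eta> = (if \<eta> (z - 1) then 1 else - 1)"
      by (simp add: excess_def)
    finally have *: "excess (z - 1) q \<eta> = (if \<eta> (z - 1) then 1 else - 1) + excess z q \<eta>" .
    have "excess z q \<eta> \<le> (if \<eta> z then 1 else 0)"
      using step.prems by (intro step.IH) simp
    moreover have "\<not> (\<eta> (z - 1) \<and> \<eta> z)" using step.prems[of "z - 1"] step.hyps by simp
    ultimately show ?case using * by (auto split: if_splits)
  qed
  then show thesis using assms(2) that by (smt (verit))
qed

text \<open>Each hole lowers the excess by 2 below its value for a full interval. The lemma provides
  an interval that can be filled only if at least \<open>n\<close> particles enter at 0.\<close>

lemma excess_deficit:
  assumes holes: "\<And>p::int. \<exists>y\<ge>p. \<not> \<eta> y"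
  shows "\<exists>q\<ge>0. excess 0 q \<eta> \<le> q + 1 - 2 * int n"
proof (induction n)
  case 0
  then show ?case using excess_le_length[of 0 0 \<eta>] by (intro exI[of _ 0]) simp
next
  case (Suc n)
  then obtain q where q: "q \<ge> 0" "excess 0 q \<eta> \<le> q + 1 - 2 * int n" by blast
  obtain y where y: "y \<ge> q + 1" "\<not> \<eta> y" using holes by blast
  have "excess 0 y \<eta> = excess 0 (y - 1) \<eta> + excess y y \<eta>"
    using excess_split[of 0 "y - 1" y \<eta>] q y by simp
  moreover have "excess y y \<eta> = - 1" using y by (simp add: excess_def)
  moreover have "excess 0 (y - 1) \<eta> = excess 0 q \<eta> + excess (q + 1) (y - 1) \<eta>"
    using q y by (intro excess_split) auto
  moreover have "excess (q + 1) (y - 1) \<eta> \<le> y - 1 - q"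
    using excess_le_length[of "q + 1" "y - 1" \<eta>] y by simp
  ultimately show ?case using q y by (intro exI[of _ y]) simp
qed

text \<open>A particle arriving at \<open>y + 1\<close> has just vacated \<open>y\<close>. Hence
  next to a permanently occupied site a hole on the right stays a hole.\<close>

lemma local_jump_arrival:
  assumes "local_jump W \<eta> \<xi>" "y \<in> W" "y + 1 \<in> W" "\<not> \<eta> (y + 1)" "\<xi> (y + 1)"
  shows "\<not> \<xi> y"
proof -
  obtain x where x: "\<forall>y\<in>W. (y = x - 1 \<longrightarrow> \<eta> y) \<and> (y = x \<longrightarrow> \<eta> y \<and> \<not> \<xi> y) \<and>
     (y = x + 1 \<longrightarrow> \<not> \<eta> y \<and> \<xi> y) \<and> (y \<noteq> x \<and> y \<noteq> x + 1 \<longrightarrow> \<xi> y = \<eta> y)"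
    using assms(1) unfolding local_jump_def by blast
  have "y = x" using x[rule_format, OF assms(3)] assms(4,5) by force
  then show ?thesis using x[rule_format, OF assms(2)] by simp
qed

lemma legalD:
  assumes "legal m e w \<omega>" "j < T * 2 ^ e" "T \<le> m"
  shows "local_jump {- int w..int w} (sample e \<omega> j) (sample e \<omega> (Suc j))"
proof -
  have "T * 2 ^ e \<le> m * 2 ^ e" using assms(3) by simp
  then show ?thesis using assms(1,2) unfolding legal_def by (meson less_le_trans)
qed

lemma never_frozen:
  assumes k: "\<And>m. m \<le> k m" and w: "\<And>m. m \<le> w m"
    and freq: "\<And>T. \<exists>C::nat. \<exists>\<^sub>F m in sequentially. legal m (k m) (w m) \<omega> \<and>
      arrivals (T * 2 ^ k m) (sample (k m) \<omega>) 0 \<le> C"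
    and live: "\<And>x T. \<exists>i e. real T \<le> real i / 2 ^ e \<and>
      \<not> (sample e \<omega> i (x - 1) \<and> sample e \<omega> i x \<and> \<not> sample e \<omega> i (x + 1))"
    and walk: "\<And>K. \<exists>L\<ge>1. K \<le> excess (- int L) (- 1) (\<omega> 0)"
    and holes: "\<And>p. \<exists>y\<ge>p. \<not> \<omega> 0 y"
  shows "\<not> (\<exists>s\<ge>0. \<forall>t\<ge>s. \<omega> t 0 = \<omega> s 0)"
proof
  have s0: "sample e \<omega> 0 = \<omega> 0" for e by (simp add: sample_def)
  assume "\<exists>s\<ge>0. \<forall>t\<ge>s. \<omega> t 0 = \<omega> s 0"
  then obtain s where s: "\<And>t. t \<ge> s \<Longrightarrow> \<omega> t 0 = \<omega> s 0" by blast
  obtain T where T: "s \<le> real T" using real_arch_simple by blast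
  obtain C where C: "\<exists>\<^sub>F m in sequentially. legal m (k m) (w m) \<omega> \<and>
      arrivals (T * 2 ^ k m) (sample (k m) \<omega>) 0 \<le> C"
    using freq by blast
  have frozen: "sample e \<omega> j 0 = \<omega> s 0" if "T * 2 ^ e \<le> j" for j e
  proof -
    have "real T * 2 ^ e \<le> real j" using that by (metis of_nat_le_iff of_nat_mult of_nat_numeral of_nat_power)
    then have "real T \<le> real j / 2 ^ e" by (simp add: field_simps)
    then show ?thesis using s[of "real j / 2 ^ e"] T by (simp add: sample_def)
  qed
  \<comment> \<open>At most \<open>C\<close> particles cross into the origin up to time
    \<open>T\<close> and none afterwards. Each costs 2, so a surplus of at least 2 remains.\<close>
  obtain L where L: "L \<ge> 1" "2 * int C + 2 \<le> excess (- int L) (- 1) (\<omega> 0)" using walk by blast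
  define \<phi> where "\<phi> = weight (\<lambda>i. i - (- int L) + 1) (- int L) (- 1)"
  define g where "g \<eta> = {y \<in> {- int L..- 1}. \<eta> y}" for \<eta> :: config
  \<comment> \<open>A constant value at the origin excludes arrivals there after \<open>T\<close>,
    so the exit of \<open>{- int L..- 1}\<close> is closed and its configuration stabilises.\<close>
  have step: "\<exists>\<^sub>F m in sequentially. \<forall>j. T * 2 ^ k m \<le> j \<and> j < m * 2 ^ k m \<longrightarrow>
      \<phi> (sample (k m) \<omega> j) \<le> \<phi> (sample (k m) \<omega> (Suc j)) \<and>
      (\<phi> (sample (k m) \<omega> j) = \<phi> (sample (k m) \<omega> (Suc j)) \<longrightarrow>
        g (sample (k m) \<omega> (Suc j)) = g (sample (k m) \<omega> j))"
  proof (rule frequently_rev_mp[OF C], rule eventually_mono[OF eventually_ge_at_top[of L]], intro allI impI)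
    fix m j assume m: "L \<le> m" and leg: "legal m (k m) (w m) \<omega> \<and> arrivals (T * 2 ^ k m) (sample (k m) \<omega>) 0 \<le> C"
      and j: "T * 2 ^ k m \<le> j \<and> j < m * 2 ^ k m"
    have 1: "local_jump {- int (w m)..int (w m)} (sample (k m) \<omega> j) (sample (k m) \<omega> (Suc j))"
      using leg j by (simp add: legal_def)
    have 2: "{- int L..- 1 + 1} \<subseteq> {- int (w m)..int (w m)}" using m w[of m] by auto
    have 3: "- int L \<le> - 1" using L by simp
    have 4: "sample (k m) \<omega> j (- 1 + 1) \<or> \<not> sample (k m) \<omega> (Suc j) (- 1 + 1)"
      using frozen[of "k m" j] frozen[of "k m" "Suc j"] j by simp
    show "\<phi> (sample (k m) \<omega> j) \<le> \<phi> (sample (k m) \<omega> (Suc j)) \<and>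
      (\<phi> (sample (k m) \<omega> j) = \<phi> (sample (k m) \<omega> (Suc j)) \<longrightarrow>
        g (sample (k m) \<omega> (Suc j)) = g (sample (k m) \<omega> j))"
      using weight_ge_of_no_departure(1)[OF 1 2 3 4] weight_ge_of_no_departure(2)[OF 1 2 3 4]
      unfolding \<phi>_def g_def by blast
  qed
  have bound: "\<phi> \<eta> \<le> (\<Sum>i\<in>{- int L..- 1}. i - (- int L) + 1)" for \<eta>
    unfolding \<phi>_def weight_def by (intro sum_mono) auto
  obtain T' where T': "T \<le> T'"
    and const: "\<forall>i e. real T' \<le> real i / 2 ^ e \<longrightarrow> g (sample e \<omega> i) = g (\<omega> (real T'))"
    by (rule monotone_observable_stabilizes[of k T \<phi> \<omega> g, OF k step bound])
  have "2 \<le> excess (- int L) (- 1) (\<omega> (real T'))"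
  proof -
    obtain m where m: "legal m (k m) (w m) \<omega>" "arrivals (T * 2 ^ k m) (sample (k m) \<omega>) 0 \<le> C" "T' + L \<le> m"
      using frequently_large[OF C] by blast
    have leg: "local_jump {- int (w m)..int (w m)} (sample (k m) \<omega> j) (sample (k m) \<omega> (Suc j))"
      if "j < T' * 2 ^ k m" for j
      using legalD[OF m(1) that] m(3) by simp
    have "arrivals (T' * 2 ^ k m) (sample (k m) \<omega>) 0 = arrivals (T * 2 ^ k m) (sample (k m) \<omega>) 0"
      using T' frozen by (intro arrivals_eq_if_none_between) (auto simp: le_Suc_eq)
    moreover have "excess (- int L) (- 1) (sample (k m) \<omega> (T' * 2 ^ k m)) = excess (- int L) (- 1) (sample (k m) \<omega> 0)
       + 2 * int (arrivals (T' * 2 ^ k m) (sample (k m) \<omega>) (- int L))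
       - 2 * int (arrivals (T' * 2 ^ k m) (sample (k m) \<omega>) (- 1 + 1))"
      using w[of m] m(3) L(1) leg by (intro excess_flux) auto
    ultimately show ?thesis using L(2) m(2) by (simp add: sample_nat s0)
  qed
  then obtain y0 where y0: "- int L \<le> y0" "y0 < - 1" "\<omega> (real T') y0" "\<omega> (real T') (y0 + 1)"
    using adjacent_particles_if_excess[of "- int L" "- 1"] L(1) by auto
  define occ where "occ y \<longleftrightarrow> (\<forall>i e. real T' \<le> real i / 2 ^ e \<longrightarrow> sample e \<omega> i y)" for y
  have "occ y" if "y \<in> {y0, y0 + 1}" for y
  proof -
    have "y \<in> g (\<omega> (real T'))" using that y0 by (auto simp: g_def)
    then show ?thesis unfolding occ_def using const by (fastforce simp: g_def)
  qed
  then have occ0: "occ y0" "occ (y0 + 1)" by auto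
  \<comment> \<open>A hole at \<open>x + 1\<close> could never be filled, since its filler would
    leave \<open>x\<close> empty. The jump from \<open>x\<close> would then stay enabled forever,
    which \<open>live\<close> forbids.\<close>
  have occ_step: "occ (x + 1)" if "occ (x - 1)" "occ x" for x
  proof (rule ccontr)
    assume "\<not> occ (x + 1)"
    then obtain i1 e1 where i1: "real T' \<le> real i1 / 2 ^ e1" "\<not> sample e1 \<omega> i1 (x + 1)"
      unfolding occ_def by blast
    obtain T1 :: nat where T1: "real i1 / 2 ^ e1 \<le> real T1" using real_arch_simple by blast
    obtain i e where ie: "real T1 \<le> real i / 2 ^ e"
        "\<not> (sample e \<omega> i (x - 1) \<and> sample e \<omega> i x \<and> \<not> sample e \<omega> i (x + 1))"
      using live by blast
    have le: "real i1 / 2 ^ e1 \<le> real i / 2 ^ e" using T1 ie by linarith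
    then have up: "sample e \<omega> i (x + 1)" using ie i1 that unfolding occ_def by force
    obtain m where m: "legal m (k m) (w m) \<omega> \<and> arrivals (T * 2 ^ k m) (sample (k m) \<omega>) 0 \<le> C"
        "nat \<bar>x\<bar> + 1 \<le> m" "e \<le> k m" "e1 \<le> k m" "real i / 2 ^ e \<le> real m"
      by (rule frequently_large_grid[OF k C])
    define a where "a = i1 * 2 ^ (k m - e1)"
    define b where "b = i * 2 ^ (k m - e)"
    have "a \<le> b" unfolding a_def b_def using dyadic_le_iff[OF m(4,3)] le by blast
    moreover have "b \<le> m * 2 ^ k m" unfolding b_def by (rule grid_index_less[OF m(3,5)])
    ultimately have "\<not> sample (k m) \<omega> b (x + 1)"
    proof (induction b rule: dec_induct)
      case base
      then show ?case using i1 by (simp add: a_def sample_refine m)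
    next
      case (step b)
      have "local_jump {- int (w m)..int (w m)} (sample (k m) \<omega> b) (sample (k m) \<omega> (Suc b))"
        using m step.prems by (simp add: legal_def)
      moreover have "x \<in> {- int (w m)..int (w m)}" "x + 1 \<in> {- int (w m)..int (w m)}"
        using m(2) w[of m] by auto
      moreover have "\<not> sample (k m) \<omega> b (x + 1)" using step by simp
      moreover have "sample (k m) \<omega> (Suc b) x"
      proof -
        have "T' * 2 ^ (k m - 0) \<le> i1 * 2 ^ (k m - e1)" using dyadic_le_iff[of 0 "k m" e1 T' i1] m i1 by simp
        then have "T' * 2 ^ k m \<le> Suc b" using step.hyps by (simp add: a_def)
        then have "real T' \<le> real (Suc b) / 2 ^ k m" using dyadic_le_iff[of 0 "k m" "k m" T' "Suc b"] by simp
        then show ?thesis using that unfolding occ_def by blast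
      qed
      ultimately show ?case using local_jump_arrival by blast
    qed
    then show False using up by (simp add: b_def sample_refine m)
  qed
  have occ: "occ (y0 + int n) \<and> occ (y0 + int n + 1)" for n
  proof (induction n)
    case (Suc n)
    then show ?case using occ_step[of "y0 + int n + 1"] by (simp add: algebra_simps)
  qed (use occ0 in simp)
  have full: "\<omega> (real T') y" if "0 \<le> y" for y
  proof -
    have "occ y" using occ[of "nat (y - y0)"] that y0 by simp
    then have "sample 0 \<omega> T' y" unfolding occ_def by (metis div_by_1 order_refl power_0)
    then show ?thesis by (simp add: sample_def)
  qed
  obtain C' where C': "\<exists>\<^sub>F m in sequentially. legal m (k m) (w m) \<omega> \<and>
      arrivals (T' * 2 ^ k m) (sample (k m) \<omega>) 0 \<le> C'"
    using freq by blast
  \<comment> \<open>Filling \<open>{0..q}\<close> by time \<open>T'\<close> takes at least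
    \<open>C' + 1\<close> arrivals at 0, one more than the current allows.\<close>
  obtain q where q: "0 \<le> q" "excess 0 q (\<omega> 0) \<le> q + 1 - 2 * int (C' + 1)"
    using excess_deficit[OF holes] by blast
  obtain m where m: "legal m (k m) (w m) \<omega>" "arrivals (T' * 2 ^ k m) (sample (k m) \<omega>) 0 \<le> C'" "T' + nat q + 1 \<le> m"
    using frequently_large[OF C'] by blast
  have leg: "local_jump {- int (w m)..int (w m)} (sample (k m) \<omega> j) (sample (k m) \<omega> (Suc j))"
    if "j < T' * 2 ^ k m" for j
    using legalD[OF m(1) that] m(3) by simp
  have "excess 0 q (sample (k m) \<omega> (T' * 2 ^ k m)) = excess 0 q (sample (k m) \<omega> 0)
     + 2 * int (arrivals (T' * 2 ^ k m) (sample (k m) \<omega>) 0)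
     - 2 * int (arrivals (T' * 2 ^ k m) (sample (k m) \<omega>) (q + 1))"
    using w[of m] m(3) q(1) leg by (intro excess_flux) auto
  moreover have "excess 0 q (\<omega> (real T')) = q + 1" using excess_full[of 0 q] full q by simp
  ultimately show False using q m(2) by (simp add: sample_nat s0)
qed

section \<open>Bernoulli walks\<close>

text \<open>It serves twice: with \<open>h\<close> an indicator for long runs of particles, and with
  \<open>h\<close> exponential in the step of the walk for the Chernoff bound.\<close>

lemma expectation_bernoulli_product:
  fixes h :: "bool \<Rightarrow> real"
  assumes "finite J" "0 \<le> \<rho>" "\<rho> \<le> 1"
  shows "integrable (bernoulli_product \<rho>) (\<lambda>\<eta>. \<Prod>i\<in>J. h (\<eta> i))"
    and "(\<integral>\<eta>. (\<Prod>i\<in>J. h (\<eta> i)) \<partial>bernoulli_product \<rho>) = (\<rho> * h True + (1 - \<rho>) * h False) ^ card J"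
proof -
  let ?M = "\<lambda>_::int. measure_pmf (bernoulli_pmf \<rho>)"
  interpret product_prob_space ?M UNIV
    by unfold_locales
  have distr: "distr (Pi\<^sub>M UNIV ?M) (Pi\<^sub>M J ?M) (\<lambda>x. restrict x J) = Pi\<^sub>M J ?M"
    by (rule distr_PiM_restrict_finite[OF assms(1)]) auto
  have meas: "(\<lambda>x. restrict x J) \<in> Pi\<^sub>M UNIV ?M \<rightarrow>\<^sub>M Pi\<^sub>M J ?M"
    by (rule measurable_restrict_subset) simp
  have int: "integrable (measure_pmf (bernoulli_pmf \<rho>)) h"
    by (rule integrable_measure_pmf_finite) simp
  have prod_int: "integrable (Pi\<^sub>M J ?M) (\<lambda>x. \<Prod>i\<in>J. h (x i))"
    by (rule product_integrable_prod[OF assms(1)]) (rule int)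
  have prod_eq: "(\<integral>x. (\<Prod>i\<in>J. h (x i)) \<partial>Pi\<^sub>M J ?M) = (\<Prod>i\<in>J. \<integral>b. h b \<partial>measure_pmf (bernoulli_pmf \<rho>))"
    by (rule product_integral_prod[OF assms(1)]) (rule int)
  have restr: "(\<Prod>i\<in>J. h (restrict \<eta> J i)) = (\<Prod>i\<in>J. h (\<eta> i))" for \<eta>
    by (rule prod.cong) auto
  have "integrable (Pi\<^sub>M UNIV ?M) (\<lambda>\<eta>. \<Prod>i\<in>J. h (restrict \<eta> J i))"
    by (rule integrable_distr[OF meas]) (simp only: distr prod_int)
  then show "integrable (bernoulli_product \<rho>) (\<lambda>\<eta>. \<Prod>i\<in>J. h (\<eta> i))"
    by (simp only: restr bernoulli_product_def)
  have "(\<integral>\<eta>. (\<Prod>i\<in>J. h (\<eta> i)) \<partial>bernoulli_product \<rho>) = (\<integral>\<eta>. (\<Prod>i\<in>J. h (restrict \<eta> J i)) \<partial>Pi\<^sub>M UNIV ?M)"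
    by (simp only: restr bernoulli_product_def)
  also have "\<dots> = (\<integral>x. (\<Prod>i\<in>J. h (x i)) \<partial>distr (Pi\<^sub>M UNIV ?M) (Pi\<^sub>M J ?M) (\<lambda>x. restrict x J))"
    by (rule integral_distr[OF meas borel_measurable_integrable[OF prod_int], symmetric])
  also have "\<dots> = (\<integral>x. (\<Prod>i\<in>J. h (x i)) \<partial>Pi\<^sub>M J ?M)"
    by (simp only: distr)
  also have "\<dots> = (\<rho> * h True + (1 - \<rho>) * h False) ^ card J"
    unfolding prod_eq using assms by (simp add: algebra_simps)
  finally show "(\<integral>\<eta>. (\<Prod>i\<in>J. h (\<eta> i)) \<partial>bernoulli_product \<rho>) = (\<rho> * h True + (1 - \<rho>) * h False) ^ card J" .
qed

lemma prob_space_bernoulli_product: "prob_space (bernoulli_product \<rho>)"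
  unfolding bernoulli_product_def by (intro prob_space_PiM measure_pmf.prob_space_axioms)

lemma space_bernoulli_product [simp]: "space (bernoulli_product \<rho>) = UNIV"
  by (simp add: bernoulli_product_def space_PiM)

lemma measurable_bernoulli_site [measurable]: "Measurable.pred (bernoulli_product \<rho>) (\<lambda>\<eta>. \<eta> x)"
proof -
  have "(\<lambda>\<eta>. \<eta> x) \<in> bernoulli_product \<rho> \<rightarrow>\<^sub>M measure_pmf (bernoulli_pmf \<rho>)"
    unfolding bernoulli_product_def by (rule measurable_component_singleton) simp
  then show ?thesis by (simp add: measurable_def)
qed

lemma measurable_excess [measurable]:
  "(\<lambda>\<eta>. real_of_int (excess p q \<eta>)) \<in> borel_measurable (bernoulli_product \<rho>)"
proof -
  have "real_of_int (excess p q \<eta>) = (\<Sum>i\<in>{p..q}. if \<eta> i then 1 else - 1)" for \<eta>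
    unfolding excess_def of_int_sum by (intro sum.cong) auto
  then show ?thesis by simp
qed

lemma AE_holes:
  assumes "0 < \<rho>" "\<rho> < 1"
  shows "AE \<eta> in bernoulli_product \<rho>. \<forall>p. \<exists>y\<ge>p. \<not> \<eta> y"
proof (subst AE_all_countable, intro allI)
  fix p :: int
  interpret prob_space "bernoulli_product \<rho>" by (rule prob_space_bernoulli_product)
  define A where "A n = {\<eta>. \<forall>y\<in>{p..<p + int n}. \<eta> y}" for n
  have A: "A n \<in> events" for n
  proof -
    have "{\<eta> \<in> space (bernoulli_product \<rho>). \<forall>y\<in>{p..<p + int n}. \<eta> y} \<in> events" by measurable
    then show ?thesis by (simp add: A_def)
  qed
  have probA: "prob (A n) = \<rho> ^ n" for n
  proof -
    have "indicat_real (A n) \<eta> = (\<Prod>y\<in>{p..<p + int n}. of_bool (\<eta> y))" for \<eta>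
      by (auto simp: A_def indicator_def)
    moreover have "prob (A n) = (\<integral>\<eta>. indicator (A n) \<eta> \<partial>bernoulli_product \<rho>)" by simp
    ultimately have "prob (A n) = (\<integral>\<eta>. (\<Prod>y\<in>{p..<p + int n}. of_bool (\<eta> y)) \<partial>bernoulli_product \<rho>)"
      by simp
    also have "\<dots> = \<rho> ^ n" using assms by (subst expectation_bernoulli_product) auto
    finally show ?thesis .
  qed
  have I: "(\<Inter>n. A n) \<in> events" using A by auto
  have "prob (\<Inter>n. A n) \<le> \<rho> ^ n" for n
    using finite_measure_mono[of "\<Inter>n. A n" "A n"] A probA[of n] by force
  then have "prob (\<Inter>n. A n) \<le> 0"
    using assms by (intro LIMSEQ_le_const[OF LIMSEQ_realpow_zero[of \<rho>]]) auto
  then have "prob (\<Inter>n. A n) = 0" by (simp add: measure_le_0_iff)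
  then have "(\<Inter>n. A n) \<in> null_sets (bernoulli_product \<rho>)"
    using I by (auto simp: null_sets_def emeasure_eq_measure)
  then show "AE \<eta> in bernoulli_product \<rho>. \<exists>y\<ge>p. \<not> \<eta> y"
    by (rule AE_I') (auto simp: A_def)
qed

text \<open>Chernoff bound for \<open>E l\<^sup>S\<close> with the optimal base \<open>l = \<surd>((1 - \<rho>) / \<rho>)\<close>.\<close>
lemma AE_excess_negative_drift:
  assumes "0 < \<rho>" "\<rho> < 1 / 2"
  obtains c where "0 < c"
    and "AE \<eta> in bernoulli_product \<rho>. \<forall>\<^sub>F n in sequentially. real_of_int (excess (- int n) 0 \<eta>) \<le> - 2 * c * real n"
proof -
  interpret prob_space "bernoulli_product \<rho>" by (rule prob_space_bernoulli_product)
  define l where "l = sqrt ((1 - \<rho>) / \<rho>)"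
  define r where "r = \<rho> * l + (1 - \<rho>) / l"
  have l: "1 < l" using assms by (simp add: l_def)
  have "(1 - \<rho>) / l = \<rho> * l"
  proof -
    have "l * l = (1 - \<rho>) / \<rho>" using assms by (simp add: l_def)
    then show ?thesis using l assms by (simp add: field_simps)
  qed
  then have r_eq: "r = 2 * \<rho> * l" by (simp add: r_def)
  \<comment> \<open>Here \<open>r\<close> is the moment generating value of one step at the optimal
    base: its square is 4 \<rho> (1 - \<rho>), that is, 1 minus the square of 1 - 2 \<rho>.\<close>
  have "0 < (1 - 2 * \<rho>)\<^sup>2" using assms by simp
  moreover have "(2 * \<rho>)\<^sup>2 * ((1 - \<rho>) / \<rho>) = 1 - (1 - 2 * \<rho>)\<^sup>2"
    using assms by (simp add: power2_eq_square) (simp add: algebra_simps)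
  ultimately have "(2 * \<rho>)\<^sup>2 * ((1 - \<rho>) / \<rho>) < 1" by simp
  then have "sqrt ((2 * \<rho>)\<^sup>2 * ((1 - \<rho>) / \<rho>)) < 1" by (simp only: real_sqrt_lt_1_iff)
  moreover have "sqrt ((2 * \<rho>)\<^sup>2 * ((1 - \<rho>) / \<rho>)) = r"
    unfolding real_sqrt_mult real_sqrt_abs r_eq l_def using assms by simp
  ultimately have "r < 1" by (simp only:)
  moreover have "0 < r" using l assms by (simp add: r_eq)
  ultimately have r: "0 < r" "r < 1" by simp_all
  \<comment> \<open>Chosen so that \<open>l powr (2 * c) * r = sqrt r\<close>: half of the
    exponential decay is given up for the threshold \<open>- 2 * c * real n\<close>, the other half
    makes the probabilities summable.\<close>
  define c where "c = ln (1 / r) / (4 * ln l)"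
  have c: "0 < c" using l r by (simp add: c_def)
  have lc: "l powr (2 * c) * r = sqrt r"
  proof -
    have "2 * c * ln l = ln (1 / r) / 2" using l by (simp add: c_def)
    also have "\<dots> = - ln (sqrt r)" using r by (simp add: ln_div ln_sqrt)
    finally have "l powr (2 * c) = inverse (sqrt r)" using l r by (simp add: powr_def exp_minus)
    then show ?thesis using r real_div_sqrt[of r] by (simp add: divide_inverse mult.commute)
  qed
  define A where "A n = {\<eta>. - 2 * c * real n < real_of_int (excess (- int n) 0 \<eta>)}" for n
  have A: "A n \<in> events" for n
  proof -
    have "{\<eta> \<in> space (bernoulli_product \<rho>). - 2 * c * real n < real_of_int (excess (- int n) 0 \<eta>)} \<in> events"
      by measurable
    then show ?thesis by (simp add: A_def)
  qed
  have prod_eq: "(\<Prod>i\<in>J. if \<eta> i then l else 1 / l) = l powr (\<Sum>i\<in>J. if \<eta> i then 1 else - 1)"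
    if "finite J" for J :: "int set" and \<eta>
    using that by (induction J) (use l in \<open>auto simp: powr_add powr_minus divide_inverse\<close>)
  have "prob (A n) \<le> sqrt r ^ n" for n
  proof -
    let ?h = "\<lambda>b. if b then l else 1 / l"
    have int: "integrable (bernoulli_product \<rho>) (\<lambda>\<eta>. \<Prod>i\<in>{- int n..0}. ?h (\<eta> i))"
      using assms by (intro expectation_bernoulli_product) auto
    have exc: "(\<Sum>i\<in>{- int n..0}. if \<eta> i then 1 else - 1) = real_of_int (excess (- int n) 0 \<eta>)" for \<eta>
      unfolding excess_def of_int_sum by (intro sum.cong) auto
    have "prob (A n) = (\<integral>\<eta>. indicator (A n) \<eta> \<partial>bernoulli_product \<rho>)" using A by simp
    also have "\<dots> \<le> (\<integral>\<eta>. l powr (2 * c * real n) * (\<Prod>i\<in>{- int n..0}. ?h (\<eta> i)) \<partial>bernoulli_product \<rho>)"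
    proof (intro integral_mono integrable_mult_right int integrable_real_indicator A)
      fix \<eta>
      have "1 \<le> l powr (2 * c * real n) * l powr real_of_int (excess (- int n) 0 \<eta>)" if "\<eta> \<in> A n"
        using that l by (simp add: A_def powr_add[symmetric] ge_one_powr_ge_zero)
      moreover have "0 \<le> l powr (2 * c * real n) * l powr real_of_int (excess (- int n) 0 \<eta>)" by simp
      ultimately show "indicat_real (A n) \<eta> \<le> l powr (2 * c * real n) * (\<Prod>i\<in>{- int n..0}. ?h (\<eta> i))"
        by (simp only: prod_eq[OF finite_atLeastAtMost_int] exc) (simp add: indicator_def)
    qed (simp add: emeasure_eq_measure)
    also have "\<dots> = l powr (2 * c * real n) * r ^ (n + 1)"
    proof -
      have "(\<integral>\<eta>. (\<Prod>i\<in>{- int n..0}. ?h (\<eta> i)) \<partial>bernoulli_product \<rho>) = (\<rho> * ?h True + (1 - \<rho>) * ?h False) ^ card {- int n..0}"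
        using assms by (intro expectation_bernoulli_product) auto
      then show ?thesis by (simp add: r_def nat_add_distrib)
    qed
    also have "\<dots> \<le> l powr (2 * c * real n) * r ^ n"
      using r by (intro mult_left_mono power_decreasing) auto
    also have "\<dots> = (l powr (2 * c) * r) ^ n"
      using l by (simp add: power_mult_distrib powr_powr[symmetric] powr_realpow)
    finally show ?thesis by (simp add: lc)
  qed
  then have "summable (\<lambda>n. prob (A n))"
    using r by (intro summable_comparison_test'[OF summable_geometric[of "sqrt r"], of 0]) auto
  then have "AE \<eta> in bernoulli_product \<rho>. \<forall>\<^sub>F n in sequentially. \<eta> \<in> space (bernoulli_product \<rho>) - A n"
    by (intro borel_cantelli_AE1 A) (auto simp: emeasure_eq_measure)
  then have "AE \<eta> in bernoulli_product \<rho>. \<forall>\<^sub>F n in sequentially. real_of_int (excess (- int n) 0 \<eta>) \<le> - 2 * c * real n"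
    by eventually_elim (auto simp: A_def elim!: eventually_mono)
  then show thesis using that c by blast
qed

section \<open>Unboundedness of the walk for densities from 1/2 on\<close>

definition walk :: "nat \<Rightarrow> (nat \<Rightarrow> bool) \<Rightarrow> int" where
  "walk n x = (\<Sum>i<n. if x i then 1 else - 1)"

lemma walk_0 [simp]: "walk 0 x = 0"
  by (simp add: walk_def)

lemma walk_Suc_case_nat: "walk (Suc n) (case_nat b x) = (if b then 1 else - 1) + walk n x"
  unfolding walk_def by (subst sum.lessThan_Suc_shift) simp

text \<open>
  The probability \<open>f k\<close> that the walk stays below \<open>k\<close> satisfies
  \<open>f (k + 1) = \<rho> f k + (1 - \<rho>) f (k + 2)\<close> and \<open>f 0 = 0\<close>. Since \<open>\<rho> \<ge> 1 - \<rho>\<close>, its increments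
  are nondecreasing, so boundedness forces \<open>f = 0\<close>.
\<close>
lemma AE_walk_unbounded:
  assumes "1 / 2 \<le> \<rho>" "\<rho> < 1"
  shows "AE x in (\<Pi>\<^sub>M i\<in>(UNIV :: nat set). measure_pmf (bernoulli_pmf \<rho>)). \<forall>k. \<exists>n. int k \<le> walk n x"
proof -
  interpret sequence_space "measure_pmf (bernoulli_pmf \<rho>)"
    by unfold_locales
  let ?M = "measure_pmf (bernoulli_pmf \<rho>)"
  define A where "A k = {x. \<forall>n. walk n x < int k}" for k
  define f where "f k = measure S (A k)" for k
  have space_S: "space S = UNIV" by (simp add: space_PiM)
  have coord [measurable]: "Measurable.pred S (\<lambda>x. x i)" for i
  proof -
    have "(\<lambda>x. x i) \<in> S \<rightarrow>\<^sub>M ?M" by (rule measurable_component_singleton) simp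
    then show ?thesis by (simp add: measurable_def)
  qed
  have walk_meas [measurable]: "(\<lambda>x. real_of_int (walk n x)) \<in> borel_measurable S" for n
  proof -
    have "real_of_int (walk n x) = (\<Sum>i<n. if x i then 1 else - 1)" for x
      unfolding walk_def of_int_sum by (intro sum.cong) auto
    moreover have "(\<lambda>x. \<Sum>i<n. if x i then 1 else - 1 :: real) \<in> borel_measurable S"
      by (intro borel_measurable_sum measurable_If coord) auto
    ultimately show ?thesis by simp
  qed
  have A: "A k \<in> sets S" for k
  proof -
    have "{x \<in> space S. \<forall>n. real_of_int (walk n x) < real k} \<in> sets S"
      by (intro sets.sets_Collect_countable_All borel_measurable_less walk_meas borel_measurable_const)
    moreover have "real_of_int (walk n x) < real k \<longleftrightarrow> walk n x < int k" for n x by linarith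
    ultimately show ?thesis by (simp add: A_def space_S)
  qed
  have A_0: "A 0 = {}" by (auto simp: A_def intro: exI[of _ 0])
  have A_case: "case_nat b x \<in> A (Suc k) \<longleftrightarrow> x \<in> A (if b then k else Suc (Suc k))" for b x k
  proof -
    have "(\<forall>n. walk n (case_nat b x) < int (Suc k)) \<longleftrightarrow> (\<forall>n. walk (Suc n) (case_nat b x) < int (Suc k))"
    proof
      assume *: "\<forall>n. walk (Suc n) (case_nat b x) < int (Suc k)"
      show "\<forall>n. walk n (case_nat b x) < int (Suc k)"
      proof
        fix n show "walk n (case_nat b x) < int (Suc k)" using * by (cases n) auto
      qed
    qed auto
    then show ?thesis by (auto simp: A_def walk_Suc_case_nat algebra_simps)
  qed
  \<comment> \<open>First-step analysis: prepending an independent first step to an i.i.d. sequence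
    reproduces its law (\<open>PiM_iter\<close>), and after that step the level is one lower or one
    higher.\<close>
  have f_rec: "f (Suc k) = \<rho> * f k + (1 - \<rho>) * f (Suc (Suc k))" for k
  proof -
    have meas: "(\<lambda>(s, x). case_nat s x) \<in> ?M \<Otimes>\<^sub>M S \<rightarrow>\<^sub>M S" by measurable
    let ?B = "(\<lambda>(s, x). case_nat s x) -` A (Suc k) \<inter> space (?M \<Otimes>\<^sub>M S)"
    have B: "?B \<in> sets (?M \<Otimes>\<^sub>M S)" using meas A by (rule measurable_sets)
    have "emeasure S (A (Suc k)) = emeasure (distr (?M \<Otimes>\<^sub>M S) S (\<lambda>(s, x). case_nat s x)) (A (Suc k))"
      by (simp only: PiM_iter)
    also have "\<dots> = emeasure (?M \<Otimes>\<^sub>M S) ?B" using meas A by (rule emeasure_distr)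
    also have "\<dots> = (\<integral>\<^sup>+b. emeasure S (Pair b -` ?B) \<partial>?M)"
      by (rule P.emeasure_pair_measure_alt[OF B])
    also have "\<dots> = (\<integral>\<^sup>+b. emeasure S (A (if b then k else Suc (Suc k))) \<partial>?M)"
    proof (rule nn_integral_cong)
      fix b
      have "Pair b -` ?B = A (if b then k else Suc (Suc k))"
        using A_case[of b _ k] by (auto simp: space_pair_measure space_S)
      then show "emeasure S (Pair b -` ?B) = emeasure S (A (if b then k else Suc (Suc k)))" by simp
    qed
    also have "\<dots> = ennreal \<rho> * emeasure S (A k) + ennreal (1 - \<rho>) * emeasure S (A (Suc (Suc k)))"
      using assms by (simp add: mult.commute)
    finally have "ennreal (f (Suc k)) = ennreal (\<rho> * f k + (1 - \<rho>) * f (Suc (Suc k)))"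
      using assms by (simp add: f_def P.emeasure_eq_measure ennreal_mult ennreal_plus)
    then show ?thesis using assms by (subst (asm) ennreal_inj) (auto simp: f_def)
  qed
  have f_mono: "f k \<le> f (Suc k)" for k
  proof -
    have "A k \<subseteq> A (Suc k)"
    proof
      fix x assume "x \<in> A k"
      then have "walk n x < int k" for n by (simp add: A_def)
      then have "walk n x < int (Suc k)" for n by (rule less_trans) simp
      then show "x \<in> A (Suc k)" by (simp add: A_def)
    qed
    then show ?thesis unfolding f_def by (rule P.finite_measure_mono[OF _ A])
  qed
  have step: "f 1 \<le> f (Suc k) - f k" for k
  proof (induction k)
    case 0
    then show ?case by (simp add: f_def A_0)
  next
    case (Suc k)
    have "(1 - \<rho>) * (f (Suc (Suc k)) - f (Suc k)) = \<rho> * (f (Suc k) - f k)"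
      using f_rec[of k] by (simp add: algebra_simps)
    also have "\<dots> \<ge> (1 - \<rho>) * (f (Suc k) - f k)"
      using assms f_mono[of k] by (intro mult_right_mono) auto
    finally have "f (Suc k) - f k \<le> f (Suc (Suc k)) - f (Suc k)" using assms by simp
    then show ?case using Suc by simp
  qed
  have lin: "real k * f 1 \<le> f k" for k
  proof (induction k)
    case (Suc k)
    then show ?case using step[of k] by (simp add: algebra_simps)
  qed (simp add: f_def)
  have "f 1 \<le> 0"
  proof (rule ccontr)
    assume "\<not> f 1 \<le> 0"
    then obtain k where "1 < real k * f 1" using reals_Archimedean3[of "f 1"] by auto
    moreover have "f k \<le> 1" unfolding f_def by (rule P.prob_le_1)
    ultimately show False using lin[of k] by linarith
  qed
  then have f1: "f 1 = 0" by (simp add: f_def measure_le_0_iff)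
  \<comment> \<open>The recursion can be solved for \<open>f (Suc (Suc k))\<close> because
    \<open>\<rho> < 1\<close>, so two consecutive zeros propagate.\<close>
  have "f k = 0 \<and> f (Suc k) = 0" for k
  proof (induction k)
    case 0
    then show ?case using f1 by (simp add: f_def A_0)
  next
    case (Suc k)
    then have "f k = 0" "f (Suc k) = 0" by blast+
    then have "(1 - \<rho>) * f (Suc (Suc k)) = 0" using f_rec[of k] by (metis add_0 mult_zero_right)
    then show ?case using \<open>f (Suc k) = 0\<close> assms by simp
  qed
  then have "A k \<in> null_sets S" for k
    using A by (auto simp: null_sets_def P.emeasure_eq_measure f_def)
  then have "AE x in S. \<exists>n. int k \<le> walk n x" for k
    by (rule AE_I') (auto simp: A_def not_le)
  then show ?thesis by (simp add: AE_all_countable)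
qed

lemma AE_excess_unbounded:
  assumes "1 / 2 \<le> \<rho>" "\<rho> < 1"
  shows "AE \<eta> in bernoulli_product \<rho>. \<forall>K. \<exists>L\<ge>1. K \<le> excess (- int L) (- 1) \<eta>"
proof -
  let ?M = "measure_pmf (bernoulli_pmf \<rho>)"
  let ?\<phi> = "\<lambda>\<eta>. \<lambda>n\<in>(UNIV :: nat set). \<eta> (- 1 - int n)"
  have walk_eq: "walk n (?\<phi> \<eta>) = excess (- int n) (- 1) \<eta>" for n \<eta>
    unfolding walk_def excess_def
    by (rule sum.reindex_bij_witness[where j = "\<lambda>i. - 1 - int i" and i = "\<lambda>i. nat (- 1 - i)"]) auto
  have distr: "distr (\<Pi>\<^sub>M i\<in>(UNIV :: int set). ?M) (\<Pi>\<^sub>M i\<in>(UNIV :: nat set). ?M) ?\<phi> = (\<Pi>\<^sub>M i\<in>(UNIV :: nat set). ?M)"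
    by (rule distr_PiM_reindex) (auto simp: inj_on_def measure_pmf.prob_space_axioms)
  have meas: "?\<phi> \<in> (\<Pi>\<^sub>M i\<in>(UNIV :: int set). ?M) \<rightarrow>\<^sub>M (\<Pi>\<^sub>M i\<in>(UNIV :: nat set). ?M)"
    by (intro measurable_restrict measurable_component_singleton) auto
  have "AE \<eta> in bernoulli_product \<rho>. \<forall>k. \<exists>n. int k \<le> walk n (?\<phi> \<eta>)"
    unfolding bernoulli_product_def
    by (rule AE_distrD[OF meas]) (unfold distr, rule AE_walk_unbounded[OF assms])
  then have "AE \<eta> in bernoulli_product \<rho>. \<forall>k. \<exists>n. int k \<le> excess (- int n) (- 1) \<eta>"
    unfolding walk_eq .
  then show ?thesis
  proof (eventually_elim, intro allI)
    case (elim \<eta>)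
    fix K :: int
    \<comment> \<open>A level of at least 1 rules out the empty interval \<open>n = 0\<close>, whose
      excess is 0.\<close>
    obtain n where "int (nat (max K 1)) \<le> excess (- int n) (- 1) \<eta>" using elim by metis
    moreover have "int (nat (max K 1)) = max K 1" by (rule nat_0_le) (simp add: le_max_iff_disj)
    ultimately have n: "K \<le> excess (- int n) (- 1) \<eta>" "1 \<le> excess (- int n) (- 1) \<eta>" by linarith+
    have "n \<noteq> 0" using n(2) by (cases n) (simp_all add: excess_def)
    then show "\<exists>L\<ge>1. K \<le> excess (- int L) (- 1) \<eta>" using n(1) by (intro exI[of _ n]) auto
  qed
qed

section \<open>Transition estimates from the generator\<close>

text \<open>Fatou's inequality for sets: the unions over \<open>m \<ge> n\<close> have probability
  at least \<open>p\<close> for large \<open>n\<close> and decrease to the limsup event.\<close>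

lemma (in prob_space) prob_frequently_ge:
  assumes meas: "\<And>n. A n \<in> events" and ge: "\<forall>\<^sub>F n in sequentially. p \<le> prob (A n)"
  shows "{\<omega> \<in> space M. \<exists>\<^sub>F n in sequentially. \<omega> \<in> A n} \<in> events"
    and "p \<le> prob {\<omega> \<in> space M. \<exists>\<^sub>F n in sequentially. \<omega> \<in> A n}"
proof -
  have eq: "{\<omega> \<in> space M. \<exists>\<^sub>F n in sequentially. \<omega> \<in> A n} = (\<Inter>n. \<Union>m\<in>{n..}. A m)"
    using sets.sets_into_space[OF meas] by (fastforce simp: frequently_sequentially)
  show "{\<omega> \<in> space M. \<exists>\<^sub>F n in sequentially. \<omega> \<in> A n} \<in> events"
    unfolding eq using meas by (intro sets.countable_INT sets.countable_UN) auto
  have U: "(\<Union>m\<in>{n..}. A m) \<in> events" for n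
    using meas by (intro sets.countable_UN'') auto
  have "decseq (\<lambda>n. \<Union>m\<in>{n..}. A m)"
    unfolding decseq_def by (intro allI impI UN_mono) auto
  then have "(\<lambda>n. prob (\<Union>m\<in>{n..}. A m)) \<longlonglongrightarrow> prob (\<Inter>n. \<Union>m\<in>{n..}. A m)"
    using U by (intro finite_Lim_measure_decseq) auto
  moreover obtain N where N: "\<And>n. n \<ge> N \<Longrightarrow> p \<le> prob (A n)"
    using ge by (auto simp: eventually_sequentially)
  have "p \<le> prob (\<Union>m\<in>{n..}. A m)" if "n \<ge> N" for n
    using N[OF that] finite_measure_mono[OF _ U[of n], of "A n"] by fastforce
  ultimately show "p \<le> prob {\<omega> \<in> space M. \<exists>\<^sub>F n in sequentially. \<omega> \<in> A n}"
    unfolding eq by (intro LIMSEQ_le_const) auto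
qed

section \<open>Cylinder events as test functions for the generator\<close>

definition cyl_event :: "(config \<Rightarrow> bool) \<Rightarrow> bool" where
  "cyl_event Q \<longleftrightarrow> (\<exists>A. finite A \<and> (\<forall>\<eta> \<xi>. (\<forall>x\<in>A. \<eta> x = \<xi> x) \<longrightarrow> Q \<eta> = Q \<xi>))"

text \<open>\<open>Bcontfun\<close> is meaningful only on bounded continuous functions. For cylinder
  events the indicator is locally constant, and it lies in the domain of the generator.\<close>

definition event_fun :: "(config \<Rightarrow> bool) \<Rightarrow> (config \<Rightarrow>\<^sub>C real)" where
  "event_fun Q = Bcontfun (\<lambda>\<eta>. of_bool (Q \<eta>))"

lemma cyl_eventI: "finite A \<Longrightarrow> (\<And>\<eta> \<xi>. (\<And>x. x \<in> A \<Longrightarrow> \<eta> x = \<xi> x) \<Longrightarrow> Q \<eta> = Q \<xi>) \<Longrightarrow> cyl_event Q"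
  unfolding cyl_event_def by blast

lemma eventually_agree:
  fixes \<eta> :: config
  assumes "finite A"
  shows "\<forall>\<^sub>F \<xi> in nhds \<eta>. \<forall>x\<in>A. \<xi> x = \<eta> x"
proof (rule eventually_ball_finite[OF assms], rule ballI)
  fix x
  have "open ((\<lambda>\<xi>. \<xi> x) -` {\<eta> x} :: config set)"
    by (intro open_vimage Topological_Spaces.open_discrete continuous_on_product_coordinates)
  then show "\<forall>\<^sub>F \<xi> in nhds \<eta>. \<xi> x = \<eta> x"
    by (rule eventually_nhds_in_open[of _ \<eta>, THEN eventually_mono]) auto
qed

lemma apply_event_fun:
  assumes "cyl_event Q"
  shows "apply_bcontfun (event_fun Q) = (\<lambda>\<eta>. of_bool (Q \<eta>))"
proof -
  obtain A where A: "finite A" "\<And>\<eta> \<xi>. \<forall>x\<in>A. \<eta> x = \<xi> x \<Longrightarrow> Q \<eta> = Q \<xi>"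
    using assms unfolding cyl_event_def by blast
  have "continuous_on UNIV (\<lambda>\<eta>. of_bool (Q \<eta>) :: real)"
    unfolding continuous_on_def
  proof (intro ballI)
    fix \<eta> :: config
    have "\<forall>\<^sub>F \<xi> in nhds \<eta>. of_bool (Q \<xi>) = (of_bool (Q \<eta>) :: real)"
    proof (rule eventually_mono[OF eventually_agree[OF A(1), of \<eta>]])
      fix \<xi> assume "\<forall>x\<in>A. \<xi> x = \<eta> x"
      then show "of_bool (Q \<xi>) = (of_bool (Q \<eta>) :: real)" using A(2)[of \<xi> \<eta>] by simp
    qed
    then show "((\<lambda>\<xi>. of_bool (Q \<xi>)) \<longlongrightarrow> (of_bool (Q \<eta>) :: real)) (at \<eta>)"
      by (intro tendsto_eventually) (simp add: eventually_nhds_conv_at)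
  qed
  moreover have "bounded (range (\<lambda>\<eta>. of_bool (Q \<eta>) :: real))"
    by (rule boundedI[of _ 1]) auto
  ultimately show ?thesis
    unfolding event_fun_def by (intro Bcontfun_inverse) (simp add: bcontfun_def)
qed

lemma cylinder_event_fun:
  assumes "cyl_event Q"
  shows "cylinder (apply_bcontfun (event_fun Q))"
  using assms unfolding apply_event_fun[OF assms] cylinder_def cyl_event_def by (simp only: of_bool_eq_iff)

lemma measurable_cyl_event:
  assumes "cyl_event Q"
  shows "Measurable.pred borel Q"
proof -
  have "apply_bcontfun (event_fun Q) \<in> borel_measurable borel"
    by (intro borel_measurable_continuous_onI continuous_on_apply_bcontfun)
  then have "{\<eta> \<in> space borel. apply_bcontfun (event_fun Q) \<eta> = 1} \<in> sets borel" by measurable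
  moreover have "{\<eta>. apply_bcontfun (event_fun Q) \<eta> = 1} = {\<eta>. Q \<eta>}"
    by (auto simp: apply_event_fun[OF assms])
  ultimately show ?thesis by (simp add: pred_def)
qed

text \<open>\<open>F\<close> only has to contain the enabled jumps that change \<open>f\<close>; if
  there are none, \<open>F = {}\<close> gives generator value 0.\<close>

lemma ftasep_op_eq_sum:
  assumes "finite F" "\<And>x. x \<notin> F \<Longrightarrow> \<eta> (x - 1) \<Longrightarrow> \<eta> x \<Longrightarrow> \<not> \<eta> (x + 1) \<Longrightarrow> f (exchange x (x + 1) \<eta>) = f \<eta>"
  shows "ftasep_op f \<eta> = (\<Sum>x\<in>F. of_bool (\<eta> (x - 1) \<and> \<eta> x \<and> \<not> \<eta> (x + 1)) * (f (exchange x (x + 1) \<eta>) - f \<eta>))"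
proof -
  have "ftasep_op f \<eta> = (\<Sum>\<^sub>\<infinity>x\<in>F. of_bool (\<eta> (x - 1) \<and> \<eta> x \<and> \<not> \<eta> (x + 1)) * (f (exchange x (x + 1) \<eta>) - f \<eta>))"
    unfolding ftasep_op_def
    by (intro infsum_cong_neutral) (use assms(2) in auto)
  then show ?thesis using assms(1) by simp
qed

section \<open>One-step estimates for a law of the process\<close>

locale ftasep_process =
  fixes S :: "real \<Rightarrow> (config \<Rightarrow>\<^sub>C real) \<Rightarrow> (config \<Rightarrow>\<^sub>C real)" and \<mu> :: "config measure"
    and P :: "(real \<Rightarrow> config) measure"
  assumes semigroup: "ftasep_semigroup S" and law: "markov_law S \<mu> P"
begin

sublocale prob_space P
  using law by (simp add: markov_law_def)

lemma sets_P [measurable_cong]: "sets P = sets path_space"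
  using law by (simp add: markov_law_def)

lemma space_P: "space P = space path_space"
  by (rule sets_eq_imp_space_eq[OF sets_P])

lemma measurable_coordinate [measurable]: "0 \<le> t \<Longrightarrow> (\<lambda>\<omega>. \<omega> t) \<in> P \<rightarrow>\<^sub>M borel"
  using coordinate_measurable[of t] by (simp add: measurable_def sets_P space_P)

lemma measurable_site [measurable]: "0 \<le> t \<Longrightarrow> Measurable.pred P (\<lambda>\<omega>. \<omega> t x)"
proof -
  assume "0 \<le> t"
  have "Measurable.pred borel (\<lambda>\<eta> :: config. \<eta> x)"
    by (rule measurable_cyl_event, rule cyl_eventI[of "{x}"]) auto
  then show ?thesis using \<open>0 \<le> t\<close> by measurable
qed

lemma measurable_natural_filtration:
  assumes "0 \<le> u" "u \<le> s"
  shows "(\<lambda>\<omega>. \<omega> u) \<in> natural_filtration s \<rightarrow>\<^sub>M (borel :: config measure)"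
proof -
  have "(\<lambda>\<omega>. restrict \<omega> {0..s}) \<in> natural_filtration s \<rightarrow>\<^sub>M (\<Pi>\<^sub>M t\<in>{0..s}. (borel :: config measure))"
    unfolding natural_filtration_def
    by (rule measurable_vimage_algebra1) (auto simp: space_PiM)
  moreover have "(\<lambda>\<omega>. \<omega> u) \<in> (\<Pi>\<^sub>M t\<in>{0..s}. (borel :: config measure)) \<rightarrow>\<^sub>M borel"
    using assms by (intro measurable_component_singleton) auto
  ultimately have "(\<lambda>\<omega>. (restrict \<omega> {0..s}) u) \<in> natural_filtration s \<rightarrow>\<^sub>M (borel :: config measure)"
    by (rule measurable_compose)
  then show ?thesis using assms by simp
qed

lemma space_natural_filtration: "space (natural_filtration s) = space P"
  by (simp add: natural_filtration_def space_P)

text \<open>The generator is a limit in supremum norm, so one threshold for \<open>t\<close> serves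
  all configurations, hence also the random state at every grid time.\<close>

lemma generator_upper_bound:
  assumes "cyl_event Q" "0 < \<epsilon>"
  shows "\<forall>\<^sub>F t in at_right 0. \<forall>\<eta>. apply_bcontfun (S t (event_fun Q)) \<eta> \<le>
     of_bool (Q \<eta>) + t * ftasep_op (\<lambda>\<xi>. of_bool (Q \<xi>)) \<eta> + \<epsilon> * t"
proof -
  obtain g where g: "(event_fun Q, g) \<in> generator S"
    "\<And>\<eta>. apply_bcontfun g \<eta> = ftasep_op (\<lambda>\<xi>. of_bool (Q \<xi>)) \<eta>"
    using semigroup cylinder_event_fun[OF assms(1)] apply_event_fun[OF assms(1)]
    unfolding ftasep_semigroup_def by metis
  have "\<forall>\<^sub>F t in at_right 0. dist ((1 / t) *\<^sub>R (S t (event_fun Q) - event_fun Q)) g < \<epsilon>"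
    using g(1) assms(2) unfolding generator_def by (auto dest: tendstoD)
  moreover have "\<forall>\<^sub>F t in at_right (0::real). 0 < t" by (simp add: eventually_at_right_less)
  ultimately show ?thesis
  proof eventually_elim
    case (elim t)
    show ?case
    proof
      fix \<eta>
      have "dist (apply_bcontfun ((1 / t) *\<^sub>R (S t (event_fun Q) - event_fun Q)) \<eta>) (apply_bcontfun g \<eta>) < \<epsilon>"
        by (rule dist_fun_lt_imp_dist_val_lt[OF elim(1)])
      then have "(apply_bcontfun (S t (event_fun Q)) \<eta> - of_bool (Q \<eta>)) / t - apply_bcontfun g \<eta> < \<epsilon>"
        by (auto simp: dist_real_def scaleR_bcontfun.rep_eq minus_bcontfun.rep_eq apply_event_fun[OF assms(1)])
      then have "apply_bcontfun (S t (event_fun Q)) \<eta> - of_bool (Q \<eta>) < (\<epsilon> + apply_bcontfun g \<eta>) * t"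
        using elim(2) by (simp add: pos_divide_less_eq[symmetric])
      then show "apply_bcontfun (S t (event_fun Q)) \<eta> \<le>
         of_bool (Q \<eta>) + t * ftasep_op (\<lambda>\<xi>. of_bool (Q \<xi>)) \<eta> + \<epsilon> * t"
        by (simp add: g(2) algebra_simps)
    qed
  qed
qed

text \<open>The Markov property integrated over a past event \<open>A\<close>: a bound on the
  semigroup for the states possible on \<open>A\<close> becomes a conditional probability
  bound.\<close>

lemma prob_next_le:
  assumes A: "A \<in> sets (natural_filtration s)" and st: "0 \<le> s" "0 \<le> t" and Q: "cyl_event Q"
    and bound: "\<And>\<omega>. \<omega> \<in> A \<Longrightarrow> apply_bcontfun (S t (event_fun Q)) (\<omega> s) \<le> \<kappa>"
  shows "prob (A \<inter> {\<omega> \<in> space P. Q (\<omega> (s + t))}) \<le> \<kappa> * prob A"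
proof -
  have sub: "subalgebra P (natural_filtration s)"
    using subalgebra_natural_filtration[of s] by (simp add: subalgebra_def sets_P space_P)
  interpret F: finite_measure_subalgebra P "natural_filtration s"
    by unfold_locales (rule sub)
  note [measurable] = measurable_cyl_event[OF Q]
  have [measurable]: "A \<in> sets P" using A sub by (auto simp: subalgebra_def)
  have "0 \<le> s + t" using st by simp
  note [measurable] = measurable_coordinate[OF this] measurable_coordinate[OF st(1)]
  have bc: "apply_bcontfun f \<in> borel_measurable borel" for f :: "config \<Rightarrow>\<^sub>C real"
    by (intro borel_measurable_continuous_onI continuous_on_apply_bcontfun)
  note [measurable] = bc
  let ?g = "\<lambda>\<omega>. apply_bcontfun (event_fun Q) (\<omega> (s + t))"
  let ?h = "\<lambda>\<omega>. apply_bcontfun (S t (event_fun Q)) (\<omega> s)"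
  have int: "integrable P (\<lambda>\<omega>. indicator A \<omega> * apply_bcontfun f (\<omega> u))"
    if "0 \<le> u" for f :: "config \<Rightarrow>\<^sub>C real" and u
  proof (rule integrable_const_bound[of _ "norm f"])
    show "AE \<omega> in P. norm (indicat_real A \<omega> * apply_bcontfun f (\<omega> u)) \<le> norm f"
      using norm_bounded[of f] by (intro AE_I2) (auto simp: indicator_def)
    have "(\<lambda>\<omega>. \<omega> u) \<in> P \<rightarrow>\<^sub>M borel" using that by simp
    then show "(\<lambda>\<omega>. indicat_real A \<omega> * apply_bcontfun f (\<omega> u)) \<in> borel_measurable P"
      by measurable
  qed
  have "prob (A \<inter> {\<omega> \<in> space P. Q (\<omega> (s + t))}) = (\<integral>\<omega>. indicator (A \<inter> {\<omega> \<in> space P. Q (\<omega> (s + t))}) \<omega> \<partial>P)"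
    by simp
  also have "\<dots> = (\<integral>\<omega>. indicator A \<omega> * ?g \<omega> \<partial>P)"
    by (rule Bochner_Integration.integral_cong) (auto simp: apply_event_fun[OF Q] indicator_def)
  also have "\<dots> = (\<integral>\<omega>. indicator A \<omega> * real_cond_exp P (natural_filtration s) ?g \<omega> \<partial>P)"
  proof (rule F.real_cond_exp_intg(2)[symmetric])
    show "integrable P (\<lambda>\<omega>. indicat_real A \<omega> * ?g \<omega>)" using st by (intro int) simp
    show "indicat_real A \<in> borel_measurable (natural_filtration s)" using A by simp
    show "?g \<in> borel_measurable P" by measurable
  qed
  also have "\<dots> = (\<integral>\<omega>. indicator A \<omega> * ?h \<omega> \<partial>P)"
  proof (rule integral_cong_AE)
    have "AE \<omega> in P. real_cond_exp P (natural_filtration s) ?g \<omega> = ?h \<omega>"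
      using law st unfolding markov_law_def by blast
    then show "AE \<omega> in P. indicat_real A \<omega> * real_cond_exp P (natural_filtration s) ?g \<omega> = indicat_real A \<omega> * ?h \<omega>"
      by eventually_elim simp
  qed measurable
  also have "\<dots> \<le> (\<integral>\<omega>. \<kappa> * indicator A \<omega> \<partial>P)"
  proof (intro integral_mono int integrable_mult_right integrable_real_indicator)
    show "indicat_real A \<omega> * ?h \<omega> \<le> \<kappa> * indicat_real A \<omega>" for \<omega>
      using bound by (auto simp: indicator_def)
  qed (use st in \<open>auto simp: emeasure_eq_measure\<close>)
  also have "\<dots> = \<kappa> * prob A" by simp
  finally show ?thesis .
qed

lemma cyl_event_in_natural_filtration:
  assumes "cyl_event Q" "0 \<le> u" "u \<le> s"
  shows "{\<omega> \<in> space P. Q (\<omega> u)} \<in> sets (natural_filtration s)"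
proof -
  note [measurable] = measurable_natural_filtration[OF assms(2,3)] measurable_cyl_event[OF assms(1)]
  have "{\<omega> \<in> space (natural_filtration s). Q (\<omega> u)} \<in> sets (natural_filtration s)" by measurable
  then show ?thesis by (simp add: space_natural_filtration)
qed

lemma cyl_event_in_events:
  assumes "cyl_event Q" "0 \<le> u"
  shows "{\<omega> \<in> space P. Q (\<omega> u)} \<in> events"
  using cyl_event_in_natural_filtration[OF assms order_refl] subalgebra_natural_filtration[of u]
  by (auto simp: subalgebra_def sets_P)

lemma exchange_is_local_jump:
  assumes "\<eta> (x - 1)" "\<eta> x" "\<not> \<eta> (x + 1)"
  shows "local_jump W \<eta> (exchange x (x + 1) \<eta>)"
  unfolding local_jump_def using assms by (intro exI[of _ x]) (auto simp: exchange_def)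

lemma local_jump_refl:
  assumes "finite W"
  shows "local_jump W \<eta> \<eta>"
proof -
  obtain x where "\<And>y. y \<in> W \<Longrightarrow> x + 1 < y"
  proof
    fix y assume "y \<in> W"
    then have "Min (insert 0 W) \<le> y" using assms by (intro Min_le) auto
    then show "Min (insert 0 W) - 2 + 1 < y" by linarith
  qed
  then show ?thesis unfolding local_jump_def by (intro exI[of _ x]) force
qed

lemma local_jump_cong:
  assumes "\<And>y. y \<in> W \<Longrightarrow> \<eta> y = \<eta>' y" "\<And>y. y \<in> W \<Longrightarrow> \<xi> y = \<xi>' y"
  shows "local_jump W \<eta> \<xi> = local_jump W \<eta>' \<xi>'"
  unfolding local_jump_def using assms by (intro ex_cong1 ball_cong) auto

text \<open>A transition \<open>Q\<close> that no single legal jump can perform has generator value 0, hence probability \<open>o(t)\<close>.\<close>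
lemma prob_not_local_jump:
  assumes W: "finite W" and "0 < \<epsilon>"
  shows "\<forall>\<^sub>F t in at_right 0. \<forall>s\<ge>0. prob {\<omega> \<in> space P. \<not> local_jump W (\<omega> s) (\<omega> (s + t))} \<le> \<epsilon> * t"
proof -
  \<comment> \<open>The generator acts on functions of one configuration, whereas
    \<open>local_jump\<close> relates two. So the earlier one is fixed through its trace
    \<open>A\<close> on \<open>W\<close>, and \<open>\<epsilon>\<close> is shared among the finitely
    many traces.\<close>
  define Q where "Q A \<eta> \<longleftrightarrow> \<not> local_jump W (\<lambda>y. y \<in> A) \<eta>" for A \<eta>
  define R where "R A \<eta> \<longleftrightarrow> {y \<in> W. \<eta> y} = A" for A and \<eta> :: config
  have Q: "cyl_event (Q A)" for A
    unfolding Q_def using W by (intro cyl_eventI[of W]) (auto cong: local_jump_cong)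
  have R: "cyl_event (R A)" for A
    unfolding R_def using W by (intro cyl_eventI[of W]) auto
  define \<delta> where "\<delta> = \<epsilon> / card (Pow W)"
  have c: "0 < card (Pow W)" using W by (auto simp: card_gt_0_iff)
  then have \<delta>: "0 < \<delta>" using assms(2) by (simp add: \<delta>_def)
  have "\<forall>\<^sub>F t in at_right 0. \<forall>A\<in>Pow W. \<forall>\<eta>. apply_bcontfun (S t (event_fun (Q A))) \<eta> \<le>
      of_bool (Q A \<eta>) + t * ftasep_op (\<lambda>\<xi>. of_bool (Q A \<xi>)) \<eta> + \<delta> * t"
    using W by (intro eventually_ball_finite ballI generator_upper_bound Q \<delta>) auto
  moreover have "\<forall>\<^sub>F t in at_right (0::real). 0 < t" by (simp add: eventually_at_right_less)
  ultimately show ?thesis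
  proof eventually_elim
    case (elim t)
    show ?case
    proof (intro allI impI)
      fix s :: real assume s: "0 \<le> s"
      let ?B = "\<lambda>A. {\<omega> \<in> space P. R A (\<omega> s)} \<inter> {\<omega> \<in> space P. Q A (\<omega> (s + t))}"
      have sub: "{\<omega> \<in> space P. \<not> local_jump W (\<omega> s) (\<omega> (s + t))} \<subseteq> (\<Union>A\<in>Pow W. ?B A)"
      proof
        fix \<omega> assume \<omega>: "\<omega> \<in> {\<omega> \<in> space P. \<not> local_jump W (\<omega> s) (\<omega> (s + t))}"
        have "local_jump W (\<lambda>y. y \<in> {y \<in> W. \<omega> s y}) (\<omega> (s + t)) = local_jump W (\<omega> s) (\<omega> (s + t))"
          by (rule local_jump_cong) auto
        then have *: "\<omega> \<in> ?B {y \<in> W. \<omega> s y}" using \<omega> by (simp add: Q_def R_def)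
        show "\<omega> \<in> (\<Union>A\<in>Pow W. ?B A)" 
          by (rule UN_I[of "{y \<in> W. \<omega> s y}"], blast, rule *)
      qed
      have meas: "?B A \<in> events" for A
        by (rule sets.Int[OF cyl_event_in_events[OF R s] cyl_event_in_events[OF Q]]) (use s elim in simp)
      have "(\<Union>A\<in>Pow W. ?B A) \<in> events"
        using W by (intro sets.finite_UN meas) simp
      then have "prob {\<omega> \<in> space P. \<not> local_jump W (\<omega> s) (\<omega> (s + t))} \<le> prob (\<Union>A\<in>Pow W. ?B A)"
        by (rule finite_measure_mono[OF sub])
      also have "\<dots> \<le> (\<Sum>A\<in>Pow W. prob (?B A))"
        using W by (intro finite_measure_subadditive_finite image_subsetI meas) simp
      also have "\<dots> \<le> (\<Sum>A\<in>Pow W. \<delta> * t)"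
      proof (rule sum_mono)
        fix A assume A: "A \<in> Pow W"
        have "prob (?B A) \<le> \<delta> * t * prob {\<omega> \<in> space P. R A (\<omega> s)}"
        proof (rule prob_next_le[OF cyl_event_in_natural_filtration[OF R s order_refl] s _ Q])
          fix \<omega> assume "\<omega> \<in> {\<omega> \<in> space P. R A (\<omega> s)}"
          then have r: "{y \<in> W. \<omega> s y} = A" by (simp add: R_def)
          have eq: "local_jump W (\<lambda>y. y \<in> A) \<xi> = local_jump W (\<omega> s) \<xi>" for \<xi>
            using r by (intro local_jump_cong) auto
          have "\<not> Q A (\<omega> s)" using local_jump_refl[OF W] by (simp add: Q_def eq)
          \<comment> \<open>Each enabled jump from a configuration with trace \<open>A\<close> is a
            local jump, so \<open>Q A\<close> stays false and every term vanishes.\<close>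
          moreover have "ftasep_op (\<lambda>\<xi>. of_bool (Q A \<xi>)) (\<omega> s) = 0"
            using calculation by (subst ftasep_op_eq_sum[where F = "{}"])
              (auto simp: Q_def eq exchange_is_local_jump)
          ultimately show "apply_bcontfun (S t (event_fun (Q A))) (\<omega> s) \<le> \<delta> * t"
            using elim(1)[rule_format, OF A, of "\<omega> s"] by simp
        qed (use elim in auto)
        also have "\<dots> \<le> \<delta> * t" using \<delta> elim(2) by (intro mult_left_le) auto
        finally show "prob (?B A) \<le> \<delta> * t" .
      qed
      also have "\<dots> = \<epsilon> * t" using c by (simp add: \<delta>_def)
      finally show "prob {\<omega> \<in> space P. \<not> local_jump W (\<omega> s) (\<omega> (s + t))} \<le> \<epsilon> * t" .
    qed
  qed
qed

text \<open>Only the jump from \<open>y - 1\<close> can fill \<open>y\<close>, at rate at most 1.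
  The second unit in the constant 2 pays for the error of the generator expansion.\<close>

lemma prob_arrival:
  "\<forall>\<^sub>F t in at_right 0. \<forall>s\<ge>0. prob {\<omega> \<in> space P. \<not> \<omega> s y \<and> \<omega> (s + t) y} \<le> 2 * t"
proof -
  define Q where "Q \<eta> \<longleftrightarrow> \<eta> y" for \<eta> :: config
  have Q: "cyl_event Q" and nQ: "cyl_event (\<lambda>\<eta>. \<not> Q \<eta>)"
    by (auto intro: cyl_eventI[of "{y}"] simp: Q_def)
  have "\<forall>\<^sub>F t in at_right 0. \<forall>\<eta>. apply_bcontfun (S t (event_fun Q)) \<eta> \<le>
      of_bool (Q \<eta>) + t * ftasep_op (\<lambda>\<xi>. of_bool (Q \<xi>)) \<eta> + 1 * t"
    by (rule generator_upper_bound[OF Q]) simp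
  moreover have "\<forall>\<^sub>F t in at_right (0::real). 0 < t" by (simp add: eventually_at_right_less)
  ultimately show ?thesis
  proof eventually_elim
    case (elim t)
    show ?case
    proof (intro allI impI)
      fix s :: real assume s: "0 \<le> s"
      have "prob ({\<omega> \<in> space P. \<not> Q (\<omega> s)} \<inter> {\<omega> \<in> space P. Q (\<omega> (s + t))})
          \<le> 2 * t * prob {\<omega> \<in> space P. \<not> Q (\<omega> s)}"
      proof (rule prob_next_le[OF cyl_event_in_natural_filtration[OF nQ s order_refl] s _ Q])
        fix \<omega> assume "\<omega> \<in> {\<omega> \<in> space P. \<not> Q (\<omega> s)}"
        then have no: "\<not> \<omega> s y" by (simp add: Q_def)
        have "ftasep_op (\<lambda>\<xi>. of_bool (Q \<xi>)) (\<omega> s) =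
          (\<Sum>x\<in>{y - 1}. of_bool (\<omega> s (x - 1) \<and> \<omega> s x \<and> \<not> \<omega> s (x + 1)) *
             (of_bool (Q (exchange x (x + 1) (\<omega> s))) - of_bool (Q (\<omega> s))))"
          using no by (intro ftasep_op_eq_sum) (auto simp: Q_def exchange_def)
        also have "\<dots> \<le> (\<Sum>x\<in>{y - 1}. 1)" by (intro sum_mono) auto
        also have "\<dots> = 1" by simp
        finally have "t * ftasep_op (\<lambda>\<xi>. of_bool (Q \<xi>)) (\<omega> s) \<le> t * 1"
          using elim(2) by (intro mult_left_mono) auto
        then show "apply_bcontfun (S t (event_fun Q)) (\<omega> s) \<le> 2 * t"
          using elim(1)[rule_format, of "\<omega> s"] no by (simp add: Q_def)
      qed (use elim in auto)
      also have "\<dots> \<le> 2 * t" using elim(2) by (intro mult_left_le) auto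
      finally have "prob ({\<omega> \<in> space P. \<not> Q (\<omega> s)} \<inter> {\<omega> \<in> space P. Q (\<omega> (s + t))}) \<le> 2 * t" .
      moreover have "{\<omega> \<in> space P. \<not> Q (\<omega> s)} \<inter> {\<omega> \<in> space P. Q (\<omega> (s + t))} =
          {\<omega> \<in> space P. \<not> \<omega> s y \<and> \<omega> (s + t) y}"
        by (auto simp: Q_def)
      ultimately show "prob {\<omega> \<in> space P. \<not> \<omega> s y \<and> \<omega> (s + t) y} \<le> 2 * t" by simp
    qed
  qed
qed

text \<open>While the jump is enabled it occurs at rate 1, so the chance of finding it enabled at n
  + 1 successive grid times is at most the n-th power of a constant below 1.\<close>

lemma AE_jump_happens:
  "AE \<omega> in P. \<exists>i e. real T \<le> real i / 2 ^ e \<and>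
      \<not> (sample e \<omega> i (x - 1) \<and> sample e \<omega> i x \<and> \<not> sample e \<omega> i (x + 1))"
proof -
  define Q where "Q \<eta> \<longleftrightarrow> \<eta> (x - 1) \<and> \<eta> x \<and> \<not> \<eta> (x + 1)" for \<eta> :: config
  have Q: "cyl_event Q"
    by (rule cyl_eventI[of "{x - 1, x, x + 1}"]) (auto simp: Q_def)
  have op: "ftasep_op (\<lambda>\<xi>. of_bool (Q \<xi>)) \<eta> \<le> - 1" if "Q \<eta>" for \<eta>
  proof -
    \<comment> \<open>Only exchanges at \<open>x - 2\<close> to \<open>x + 1\<close> touch the three
      sites of \<open>Q\<close>. As \<open>Q \<eta>\<close> holds, no term is positive, and the jump
      from \<open>x\<close> itself contributes -1.\<close>
    have "ftasep_op (\<lambda>\<xi>. of_bool (Q \<xi>)) \<eta> =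
        (\<Sum>z\<in>{x - 3..x + 3}. of_bool (\<eta> (z - 1) \<and> \<eta> z \<and> \<not> \<eta> (z + 1)) *
           (of_bool (Q (exchange z (z + 1) \<eta>)) - of_bool (Q \<eta>)))"
      by (intro ftasep_op_eq_sum) (auto simp: Q_def exchange_def)
    also have "\<dots> \<le> (\<Sum>z\<in>{x - 3..x + 3}. if z = x then - 1 else 0)"
      using that by (intro sum_mono) (auto simp: Q_def exchange_def)
    also have "\<dots> = - 1" by simp
    finally show ?thesis .
  qed
  have "\<forall>\<^sub>F t in at_right 0. \<forall>\<eta>. apply_bcontfun (S t (event_fun Q)) \<eta> \<le>
      of_bool (Q \<eta>) + t * ftasep_op (\<lambda>\<xi>. of_bool (Q \<xi>)) \<eta> + 1 / 2 * t"
    by (rule generator_upper_bound[OF Q]) simp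
  moreover have lim: "filterlim (\<lambda>e. 1 / 2 ^ e :: real) (at_right 0) sequentially"
    by real_asymp
  ultimately have "\<forall>\<^sub>F e in sequentially. \<forall>\<eta>. apply_bcontfun (S (1 / 2 ^ e) (event_fun Q)) \<eta> \<le>
      of_bool (Q \<eta>) + (1 / 2 ^ e) * ftasep_op (\<lambda>\<xi>. of_bool (Q \<xi>)) \<eta> + 1 / 2 * (1 / 2 ^ e)"
    by (rule eventually_compose_filterlim)
  then obtain e where e: "\<And>\<eta>. apply_bcontfun (S (1 / 2 ^ e) (event_fun Q)) \<eta> \<le>
      of_bool (Q \<eta>) + (1 / 2 ^ e) * ftasep_op (\<lambda>\<xi>. of_bool (Q \<xi>)) \<eta> + 1 / 2 * (1 / 2 ^ e)"
    by (auto dest!: eventually_happens)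
  define t :: real where "t = 1 / 2 ^ e"
  have t: "0 < t" "t \<le> 1" by (auto simp: t_def)
  \<comment> \<open>Rate 1 removes \<open>t\<close>; the error allowance returns
    \<open>t / 2\<close>.\<close>
  define \<kappa> where "\<kappa> = 1 - t / 2"
  have \<kappa>: "0 \<le> \<kappa>" "\<kappa> < 1" using t by (auto simp: \<kappa>_def)
  have decay: "apply_bcontfun (S t (event_fun Q)) \<eta> \<le> \<kappa>" if "Q \<eta>" for \<eta>
  proof -
    have "t * ftasep_op (\<lambda>\<xi>. of_bool (Q \<xi>)) \<eta> \<le> t * (- 1)"
      using op[OF that] t by (intro mult_left_mono) auto
    then show ?thesis using e[of \<eta>] that by (simp add: t_def \<kappa>_def)
  qed
  define A where "A n = {\<omega> \<in> space P. \<forall>i\<le>n. Q (\<omega> (real T + real i * t))}" for n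
  have A_eq: "A n = (\<Inter>i\<in>{..n}. {\<omega> \<in> space P. Q (\<omega> (real T + real i * t))})" for n
    by (auto simp: A_def)
  have A_nf: "A n \<in> sets (natural_filtration (real T + real n * t))" for n
    unfolding A_eq using t
    by (intro sets.finite_INT cyl_event_in_natural_filtration Q) (auto intro!: mult_right_mono)
  have A_meas: "A n \<in> events" for n
    using A_nf[of n] subalgebra_natural_filtration[of "real T + real n * t"]
    by (auto simp: subalgebra_def sets_P)
  have prob_A: "prob (A n) \<le> \<kappa> ^ n" for n
  proof (induction n)
    case (Suc n)
    have "A (Suc n) = A n \<inter> {\<omega> \<in> space P. Q (\<omega> (real T + real n * t + t))}"
      by (auto simp: A_def le_Suc_eq algebra_simps)
    also have "prob \<dots> \<le> \<kappa> * prob (A n)"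
      using t by (intro prob_next_le A_nf Q decay) (auto simp: A_def)
    also have "\<dots> \<le> \<kappa> * \<kappa> ^ n" using Suc \<kappa> by (intro mult_left_mono) auto
    finally show ?case by simp
  qed simp
  have "prob (\<Inter>n. A n) \<le> \<kappa> ^ n" for n
    using finite_measure_mono[of "\<Inter>n. A n" "A n"] A_meas prob_A[of n] by force
  then have "prob (\<Inter>n. A n) \<le> 0"
    using \<kappa> by (intro LIMSEQ_le_const[OF LIMSEQ_realpow_zero[of \<kappa>]]) auto
  then have "prob (\<Inter>n. A n) = 0" by (simp add: measure_le_0_iff)
  then have "(\<Inter>n. A n) \<in> null_sets P"
    using A_meas by (auto simp: null_sets_def emeasure_eq_measure)
  then show ?thesis
  proof (rule AE_I', intro subsetI)
    fix \<omega> assume \<omega>: "\<omega> \<in> {\<omega> \<in> space P. \<not> (\<exists>i e. real T \<le> real i / 2 ^ e \<and>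
      \<not> (sample e \<omega> i (x - 1) \<and> sample e \<omega> i x \<and> \<not> sample e \<omega> i (x + 1)))}"
    have Q_dyadic: "Q (\<omega> (real i / 2 ^ e))" if "real T \<le> real i / 2 ^ e" for i e
      using \<omega> that by (auto simp: sample_def Q_def)
    have "Q (\<omega> (real T + real i * t))" for i
    proof -
      have eq: "real T + real i * t = real (T * 2 ^ e + i) / 2 ^ e"
        by (simp add: t_def add_divide_distrib)
      have "real T \<le> real (T * 2 ^ e + i) / 2 ^ e"
        using t unfolding eq[symmetric] by simp
      then show ?thesis unfolding eq by (rule Q_dyadic)
    qed
    then show "\<omega> \<in> (\<Inter>n. A n)" using \<omega> by (auto simp: A_def)
  qed
qed

section \<open>Grids that are legal with probability close to 1\<close>

lemma cyl_event_local_jump: "finite W \<Longrightarrow> cyl_event (local_jump W \<eta>)"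
  by (rule cyl_eventI[of W]) (auto cong: local_jump_cong)

lemma local_jump_event:
  assumes "finite W" "0 \<le> s" "0 \<le> t"
  shows "{\<omega> \<in> space P. local_jump W (\<omega> s) (\<omega> t)} \<in> events"
proof -
  define B where "B A = {\<omega> \<in> space P. (\<lambda>\<eta>. {y \<in> W. \<eta> y} = A) (\<omega> s)} \<inter> {\<omega> \<in> space P. local_jump W (\<lambda>y. y \<in> A) (\<omega> t)}" for A
  have c: "cyl_event (\<lambda>\<eta>. {y \<in> W. \<eta> y} = A)" for A
    using assms(1) by (intro cyl_eventI[of W]) auto
  have "B A \<in> events" for A
    unfolding B_def
    by (rule sets.Int[OF cyl_event_in_events[OF c assms(2)] cyl_event_in_events[OF cyl_event_local_jump[OF assms(1)] assms(3)]])
  then have "(\<Union>A\<in>Pow W. B A) \<in> events" using assms(1) by (intro sets.finite_UN) auto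
  moreover have "{\<omega> \<in> space P. local_jump W (\<omega> s) (\<omega> t)} = (\<Union>A\<in>Pow W. B A)"
  proof -
    have "local_jump W (\<omega> s) (\<omega> t) \<longleftrightarrow> (\<exists>A\<in>Pow W. {y \<in> W. \<omega> s y} = A \<and> local_jump W (\<lambda>y. y \<in> A) (\<omega> t))" for \<omega>
    proof -
      have "local_jump W (\<lambda>y. y \<in> {y \<in> W. \<omega> s y}) (\<omega> t) = local_jump W (\<omega> s) (\<omega> t)"
        by (rule local_jump_cong) auto
      then show ?thesis by auto
    qed
    then show ?thesis unfolding B_def by auto
  qed
  ultimately show ?thesis by simp
qed

lemma legal_event: "{\<omega> \<in> space P. legal m e w \<omega>} \<in> events"
proof -
  have "{\<omega> \<in> space P. legal m e w \<omega>} = space P \<inter> (\<Inter>j\<in>{..<m * 2 ^ e}.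
      {\<omega> \<in> space P. local_jump {- int w..int w} (sample e \<omega> j) (sample e \<omega> (Suc j))})"
    by (auto simp: legal_def)
  also have "\<dots> \<in> events"
  proof (cases "m = 0")
    case False
    then have "{..<m * 2 ^ e} \<noteq> {}" by (auto simp: lessThan_empty_iff)
    then show ?thesis
      unfolding sample_def by (intro sets.Int sets.top sets.finite_INT local_jump_event) auto
  qed simp
  finally show ?thesis .
qed

lemma measurable_arrivals [measurable]:
  "(\<lambda>\<omega>. real (arrivals n (sample e \<omega>) y)) \<in> borel_measurable P"
proof (induction n)
  case (Suc n)
  have "Measurable.pred P (\<lambda>\<omega>. \<not> \<omega> (real n / 2 ^ e) y \<and> \<omega> (real (Suc n) / 2 ^ e) y)"
    by (intro pred_intros_logic measurable_site) auto
  then have "(\<lambda>\<omega>. of_bool (\<not> \<omega> (real n / 2 ^ e) y \<and> \<omega> (real (Suc n) / 2 ^ e) y) :: real) \<in> borel_measurable P"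
    by measurable
  then have "(\<lambda>\<omega>. real (arrivals n (sample e \<omega>) y) +
      of_bool (\<not> sample e \<omega> n y \<and> sample e \<omega> (Suc n) y)) \<in> borel_measurable P"
    unfolding sample_def[of e _ n] sample_def[of e _ "Suc n"] by (intro borel_measurable_add Suc)
  then show ?case by (simp add: arrivals_Suc)
qed simp

text \<open>Union bound over all grid steps: an error proportional to the mesh sums to a bound that
  depends on the horizon alone, which is why the error per step has to be
  \<open>o(t)\<close>.\<close>

lemma prob_not_legal:
  assumes step: "\<And>s. 0 \<le> s \<Longrightarrow> prob {\<omega> \<in> space P. \<not> local_jump {- int w..int w} (\<omega> s) (\<omega> (s + 1 / 2 ^ e))} \<le> \<epsilon> / 2 ^ e"
  shows "prob {\<omega> \<in> space P. \<not> legal m e w \<omega>} \<le> real m * \<epsilon>"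
proof -
  define B where "B j = {\<omega> \<in> space P. \<not> local_jump {- int w..int w} (sample e \<omega> j) (sample e \<omega> (Suc j))}" for j
  have B: "B j \<in> events" for j
  proof -
    have "B j = space P - {\<omega> \<in> space P. local_jump {- int w..int w} (\<omega> (real j / 2 ^ e)) (\<omega> (real (Suc j) / 2 ^ e))}"
      by (auto simp: B_def sample_def)
    then show ?thesis by (simp only:) (intro sets.compl_sets local_jump_event, auto)
  qed
  have "prob {\<omega> \<in> space P. \<not> legal m e w \<omega>} = prob (\<Union>j\<in>{..<m * 2 ^ e}. B j)"
    by (rule arg_cong[where f = prob]) (auto simp: legal_def B_def)
  also have "\<dots> \<le> (\<Sum>j\<in>{..<m * 2 ^ e}. prob (B j))"
    using B by (intro finite_measure_subadditive_finite) auto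
  also have "\<dots> \<le> (\<Sum>j\<in>{..<m * 2 ^ e}. \<epsilon> / 2 ^ e)"
  proof (rule sum_mono)
    fix j
    have "real j / 2 ^ e + 1 / 2 ^ e = real (Suc j) / 2 ^ e" by (simp add: add_divide_distrib)
    then show "prob (B j) \<le> \<epsilon> / 2 ^ e"
      using step[of "real j / 2 ^ e"] unfolding B_def sample_def by simp
  qed
  also have "\<dots> = real m * \<epsilon>" by simp
  finally show ?thesis .
qed

text \<open>Markov's inequality. The mean number of arrivals is at most \<open>2 * real T\<close>
  for every admissible mesh, because the bound per step is proportional to the mesh.\<close>

lemma prob_arrivals_ge:
  assumes step: "\<And>s. 0 \<le> s \<Longrightarrow> prob {\<omega> \<in> space P. \<not> \<omega> s y \<and> \<omega> (s + 1 / 2 ^ e) y} \<le> 2 / 2 ^ e"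
    and "0 < a"
  shows "prob {\<omega> \<in> space P. a \<le> real (arrivals (T * 2 ^ e) (sample e \<omega>) y)} \<le> 2 * real T / a"
proof -
  have "integrable P (\<lambda>\<omega>. real (arrivals n (sample e \<omega>) y)) \<and>
      (\<integral>\<omega>. real (arrivals n (sample e \<omega>) y) \<partial>P) \<le> real n * (2 / 2 ^ e)" for n
  proof (induction n)
    case (Suc n)
    define B where "B = {\<omega> \<in> space P. \<not> \<omega> (real n / 2 ^ e) y \<and> \<omega> (real (Suc n) / 2 ^ e) y}"
    have "Measurable.pred P (\<lambda>\<omega>. \<not> \<omega> (real n / 2 ^ e) y \<and> \<omega> (real (Suc n) / 2 ^ e) y)"
      by (intro pred_intros_logic measurable_site) auto
    then have B: "B \<in> events" unfolding B_def pred_def .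
    have intB: "integrable P (indicat_real B)"
      using B by (intro integrable_real_indicator) (auto simp: emeasure_eq_measure)
    have eq: "real (arrivals (Suc n) (sample e \<omega>) y) = real (arrivals n (sample e \<omega>) y) + indicat_real B \<omega>"
      if "\<omega> \<in> space P" for \<omega>
      using that by (simp add: arrivals_Suc B_def sample_def indicator_def)
    have "integrable P (\<lambda>\<omega>. real (arrivals (Suc n) (sample e \<omega>) y)) \<longleftrightarrow>
        integrable P (\<lambda>\<omega>. real (arrivals n (sample e \<omega>) y) + indicat_real B \<omega>)"
      by (rule Bochner_Integration.integrable_cong) (auto simp: eq)
    moreover have "(\<integral>\<omega>. real (arrivals (Suc n) (sample e \<omega>) y) \<partial>P) =
        (\<integral>\<omega>. real (arrivals n (sample e \<omega>) y) + indicat_real B \<omega> \<partial>P)"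
      by (rule Bochner_Integration.integral_cong) (auto simp: eq)
    moreover have "prob B \<le> 2 / 2 ^ e"
    proof -
      have "real n / 2 ^ e + 1 / 2 ^ e = real (Suc n) / 2 ^ e" by (simp add: add_divide_distrib)
      then show ?thesis using step[of "real n / 2 ^ e"] unfolding B_def by simp
    qed
    ultimately show ?case
      using Suc intB B by (simp add: Bochner_Integration.integral_add algebra_simps add_divide_distrib)
  qed simp
  from this[of "T * 2 ^ e"] have int: "integrable P (\<lambda>\<omega>. real (arrivals (T * 2 ^ e) (sample e \<omega>) y))"
    and le: "(\<integral>\<omega>. real (arrivals (T * 2 ^ e) (sample e \<omega>) y) \<partial>P) \<le> 2 * real T"
    by auto
  have "prob {\<omega> \<in> space P. a \<le> real (arrivals (T * 2 ^ e) (sample e \<omega>) y)} \<le>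
      (\<integral>\<omega>. real (arrivals (T * 2 ^ e) (sample e \<omega>) y) \<partial>P) / a"
    using \<open>0 < a\<close> by (intro integral_Markov_inequality_measure[OF int, of "{}"]) auto
  also have "\<dots> \<le> 2 * real T / a" using le \<open>0 < a\<close> by (intro divide_right_mono) auto
  finally show ?thesis .
qed

text \<open>The half-width \<open>m * m\<close> is quadratic in the horizon \<open>m\<close>: the
  mean inflow at the left end up to time \<open>m\<close> is of order \<open>m\<close>, negligible
  against a drift of order \<open>m * m\<close>. The other site, 0, is where the current past the
  origin is measured.\<close>

definition fine_grid :: "nat \<Rightarrow> nat \<Rightarrow> bool" where
  "fine_grid m e \<longleftrightarrow> m \<le> e \<and> prob {\<omega> \<in> space P. \<not> legal m e (m * m) \<omega>} \<le> 1 / (real m + 1) \<and>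
     (\<forall>T a y. 0 < a \<longrightarrow> y \<in> {0, - int (m * m)} \<longrightarrow>
       prob {\<omega> \<in> space P. a \<le> real (arrivals (T * 2 ^ e) (sample e \<omega>) y)} \<le> 2 * real T / a)"

lemma fine_gridD:
  assumes "fine_grid m e"
  shows "m \<le> e" "prob {\<omega> \<in> space P. \<not> legal m e (m * m) \<omega>} \<le> 1 / (real m + 1)"
    and "0 < a \<Longrightarrow> y \<in> {0, - int (m * m)} \<Longrightarrow>
      prob {\<omega> \<in> space P. a \<le> real (arrivals (T * 2 ^ e) (sample e \<omega>) y)} \<le> 2 * real T / a"
  using assms unfolding fine_grid_def by blast+

lemma exists_fine_grid: "\<exists>k. \<forall>m. fine_grid m (k m)"
proof (rule choice, rule allI)
  fix m
  have lim: "filterlim (\<lambda>e. 1 / 2 ^ e :: real) (at_right 0) sequentially"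
    by real_asymp
  show "\<exists>e. fine_grid m e"
  proof -
    \<comment> \<open>The factor \<open>m\<close> from the horizon still has to leave
      \<open>1 / (real m + 1)\<close>.\<close>
    define \<epsilon> where "\<epsilon> = 1 / (real m + 1)\<^sup>2"
    have "0 < \<epsilon>" by (simp add: \<epsilon>_def)
    have "\<forall>\<^sub>F e in sequentially. \<forall>s\<ge>0. prob {\<omega> \<in> space P.
        \<not> local_jump {- int (m * m)..int (m * m)} (\<omega> s) (\<omega> (s + 1 / 2 ^ e))} \<le> \<epsilon> * (1 / 2 ^ e)"
      by (rule eventually_compose_filterlim[OF prob_not_local_jump[OF _ \<open>0 < \<epsilon>\<close>] lim]) simp
    moreover have "\<forall>\<^sub>F e in sequentially. \<forall>s\<ge>0. prob {\<omega> \<in> space P. \<not> \<omega> s y \<and> \<omega> (s + 1 / 2 ^ e) y} \<le> 2 * (1 / 2 ^ e)" for y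
      by (rule eventually_compose_filterlim[OF prob_arrival lim])
    note this[of 0] this[of "- int (m * m)"]
    ultimately have "\<forall>\<^sub>F e in sequentially. m \<le> e \<and> (\<forall>s\<ge>0. prob {\<omega> \<in> space P.
        \<not> local_jump {- int (m * m)..int (m * m)} (\<omega> s) (\<omega> (s + 1 / 2 ^ e))} \<le> \<epsilon> * (1 / 2 ^ e)) \<and>
        (\<forall>y\<in>{0, - int (m * m)}. \<forall>s\<ge>0. prob {\<omega> \<in> space P. \<not> \<omega> s y \<and> \<omega> (s + 1 / 2 ^ e) y} \<le> 2 * (1 / 2 ^ e))"
      using eventually_ge_at_top[of m] by eventually_elim blast
    then obtain e where e: "m \<le> e"
      "\<And>s. 0 \<le> s \<Longrightarrow> prob {\<omega> \<in> space P.
        \<not> local_jump {- int (m * m)..int (m * m)} (\<omega> s) (\<omega> (s + 1 / 2 ^ e))} \<le> \<epsilon> * (1 / 2 ^ e)"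
      "\<And>y s. y \<in> {0, - int (m * m)} \<Longrightarrow> 0 \<le> s \<Longrightarrow>
        prob {\<omega> \<in> space P. \<not> \<omega> s y \<and> \<omega> (s + 1 / 2 ^ e) y} \<le> 2 * (1 / 2 ^ e)"
      using eventually_happens'[OF sequentially_bot] by blast
    show ?thesis
      unfolding fine_grid_def
    proof (intro exI[of _ e] conjI allI impI)
      have "prob {\<omega> \<in> space P. \<not> legal m e (m * m) \<omega>} \<le> real m * \<epsilon>"
        using e(2) by (intro prob_not_legal) simp
      also have "\<dots> \<le> (real m + 1) * \<epsilon>"
        using \<open>0 < \<epsilon>\<close> by (intro mult_right_mono) auto
      also have "\<dots> = 1 / (real m + 1)"
        unfolding \<epsilon>_def by (simp add: power2_eq_square)
      finally show "prob {\<omega> \<in> space P. \<not> legal m e (m * m) \<omega>} \<le> 1 / (real m + 1)" .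
      show "prob {\<omega> \<in> space P. a \<le> real (arrivals (T * 2 ^ e) (sample e \<omega>) y)} \<le> 2 * real T / a"
        if "0 < a" "y \<in> {0, - int (m * m)}" for T a y
        using e(3)[OF that(2)] that(1) by (intro prob_arrivals_ge) simp_all
    qed (rule e)
  qed
qed

text \<open>Common part of the next two lemmas: the illegal grids have vanishing probability and
  disappear into \<open>\<delta>\<close>, so only the tail \<open>q\<close> of the current is
  lost.\<close>

lemma prob_frequently_legal:
  fixes n a :: "nat \<Rightarrow> _" and y :: "nat \<Rightarrow> int"
  assumes grid: "\<forall>m. fine_grid m (k m)"
    and arr: "\<forall>\<^sub>F m in sequentially.
      prob {\<omega> \<in> space P. a m \<le> real (arrivals (n m * 2 ^ k m) (sample (k m) \<omega>) (y m))} \<le> q"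
    and "0 < \<delta>"
  defines "G m \<equiv> {\<omega> \<in> space P. legal m (k m) (m * m) \<omega> \<and> real (arrivals (n m * 2 ^ k m) (sample (k m) \<omega>) (y m)) < a m}"
  shows "{\<omega> \<in> space P. \<exists>\<^sub>F m in sequentially. \<omega> \<in> G m} \<in> events"
    and "1 - q - \<delta> \<le> prob {\<omega> \<in> space P. \<exists>\<^sub>F m in sequentially. \<omega> \<in> G m}"
proof -
  have G: "G m \<in> events" for m
  proof -
    have "G m = {\<omega> \<in> space P. legal m (k m) (m * m) \<omega>} \<inter>
        {\<omega> \<in> space P. real (arrivals (n m * 2 ^ k m) (sample (k m) \<omega>) (y m)) < a m}"
      by (auto simp: G_def)
    also have "\<dots> \<in> events" by (intro sets.Int legal_event) measurable
    finally show ?thesis .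
  qed
  have "(\<lambda>m. 1 / (real m + 1)) \<longlonglongrightarrow> 0" by real_asymp
  then have "\<forall>\<^sub>F m in sequentially. 1 / (real m + 1) < \<delta>" using \<open>0 < \<delta>\<close> by (rule order_tendstoD)
  with arr have ev: "\<forall>\<^sub>F m in sequentially. 1 - q - \<delta> \<le> prob (G m)"
  proof eventually_elim
    case (elim m)
    let ?L = "{\<omega> \<in> space P. \<not> legal m (k m) (m * m) \<omega>}"
    let ?R = "{\<omega> \<in> space P. a m \<le> real (arrivals (n m * 2 ^ k m) (sample (k m) \<omega>) (y m))}"
    have "?L = space P - {\<omega> \<in> space P. legal m (k m) (m * m) \<omega>}" by auto
    then have L: "?L \<in> events" using legal_event by (simp add: sets.compl_sets)
    have R: "?R \<in> events" by measurable
    have "space P - G m = ?L \<union> ?R" by (auto simp: G_def)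
    then have "prob (space P - G m) \<le> prob ?L + prob ?R"
      using measure_Un_le[OF L R] by simp
    then show ?case using prob_compl[OF G[of m]] fine_gridD(2)[OF grid[rule_format, of m]] elim by simp
  qed
  show "{\<omega> \<in> space P. \<exists>\<^sub>F m in sequentially. \<omega> \<in> G m} \<in> events"
    by (rule prob_frequently_ge(1)[OF G ev])
  show "1 - q - \<delta> \<le> prob {\<omega> \<in> space P. \<exists>\<^sub>F m in sequentially. \<omega> \<in> G m}"
    by (rule prob_frequently_ge(2)[OF G ev])
qed

text \<open>Markov's inequality leaves \<open>4 / (c * real m)\<close>, which tends to 0, so the
  limsup event has probability above every number less than 1.\<close>

lemma AE_frequently_legal_small_inflow:
  assumes grid: "\<forall>m. fine_grid m (k m)"
    and "0 < c"
  shows "AE \<omega> in P. \<exists>\<^sub>F m in sequentially. legal m (k m) (m * m) \<omega> \<and>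
      2 * real (arrivals (m * 2 ^ k m) (sample (k m) \<omega>) (- int (m * m))) \<le> c * real (m * m)"
proof -
  define G where "G m = {\<omega> \<in> space P. legal m (k m) (m * m) \<omega> \<and>
      real (arrivals (m * 2 ^ k m) (sample (k m) \<omega>) (- int (m * m))) < c * real (m * m) / 2}" for m
  define F where "F = {\<omega> \<in> space P. \<exists>\<^sub>F m in sequentially. \<omega> \<in> G m}"
  have ev: "\<forall>\<^sub>F m in sequentially. prob {\<omega> \<in> space P. c * real (m * m) / 2 \<le>
      real (arrivals (m * 2 ^ k m) (sample (k m) \<omega>) (- int (m * m)))} \<le> \<delta>" if "0 < \<delta>" for \<delta>
  proof -
    have "(\<lambda>m. 4 / (c * real m)) \<longlonglongrightarrow> 0" using \<open>0 < c\<close> by real_asymp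
    then have "\<forall>\<^sub>F m in sequentially. 4 / (c * real m) < \<delta>" using that by (rule order_tendstoD)
    then show ?thesis using eventually_gt_at_top[of 0]
    proof eventually_elim
      case (elim m)
      have "prob {\<omega> \<in> space P. c * real (m * m) / 2 \<le>
          real (arrivals (m * 2 ^ k m) (sample (k m) \<omega>) (- int (m * m)))} \<le> 2 * real m / (c * real (m * m) / 2)"
        using elim \<open>0 < c\<close> by (intro fine_gridD(3)[OF grid[rule_format]]) auto
      also have "\<dots> = 4 / (c * real m)" using elim \<open>0 < c\<close> by (simp add: field_simps)
      finally show ?case using elim by simp
    qed
  qed
  have "F \<in> events"
    unfolding F_def G_def using prob_frequently_legal(1)[OF grid ev[of 1], where \<delta> = 1] by simp
  moreover have "1 \<le> prob F"
  proof (rule field_le_epsilon)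
    fix \<delta> :: real assume "0 < \<delta>"
    then show "1 \<le> prob F + \<delta>"
      unfolding F_def G_def using prob_frequently_legal(2)[OF grid ev[of "\<delta> / 2"], where \<delta> = "\<delta> / 2"] by simp
  qed
  ultimately have "AE \<omega> in P. \<omega> \<in> F" by (simp add: prob_eq_1[symmetric] antisym)
  then show ?thesis
    by eventually_elim (auto simp: F_def G_def elim!: frequently_elim1)
qed

text \<open>For fixed \<open>T\<close> the currents are tight in \<open>m\<close> but need not be
  bounded by a common constant. So \<open>C\<close> depends on the path: each \<open>C\<close> has a
  limsup event, and the probabilities of these tend to 1.\<close>

lemma AE_frequently_legal_bounded_inflow:
  assumes grid: "\<forall>m. fine_grid m (k m)"
  shows "AE \<omega> in P. \<exists>C::nat. \<exists>\<^sub>F m in sequentially. legal m (k m) (m * m) \<omega> \<and>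
      arrivals (T * 2 ^ k m) (sample (k m) \<omega>) 0 \<le> C"
proof -
  define G where "G C m = {\<omega> \<in> space P. legal m (k m) (m * m) \<omega> \<and>
      real (arrivals (T * 2 ^ k m) (sample (k m) \<omega>) 0) < real (Suc C)}" for C m
  define F where "F C = {\<omega> \<in> space P. \<exists>\<^sub>F m in sequentially. \<omega> \<in> G C m}" for C
  have ev: "\<forall>\<^sub>F m in sequentially. prob {\<omega> \<in> space P. real (Suc C) \<le>
      real (arrivals (T * 2 ^ k m) (sample (k m) \<omega>) 0)} \<le> 2 * real T / real (Suc C)" for C
    by (intro always_eventually allI fine_gridD(3)[OF grid[rule_format]]) auto
  have F: "F C \<in> events" for C
    unfolding F_def G_def using prob_frequently_legal(1)[OF grid ev[of C], where \<delta> = 1] by simp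
  then have UF: "(\<Union>C. F C) \<in> events" by auto
  have le: "1 - 2 * real T / real (Suc C) - 1 / real (Suc C) \<le> prob (\<Union>C. F C)" for C
  proof -
    have "1 - 2 * real T / real (Suc C) - 1 / real (Suc C) \<le> prob (F C)"
      unfolding F_def G_def by (rule prob_frequently_legal(2)[OF grid ev[of C]]) simp
    also have "\<dots> \<le> prob (\<Union>C. F C)" using UF by (intro finite_measure_mono) auto
    finally show ?thesis .
  qed
  moreover have "(\<lambda>C. 1 - 2 * real T / real (Suc C) - 1 / real (Suc C)) \<longlonglongrightarrow> 1" by real_asymp
  ultimately have "1 \<le> prob (\<Union>C. F C)" by (intro LIMSEQ_le_const2) auto
  then have "prob (\<Union>C. F C) = 1" by (intro antisym) simp_all
  then have "AE \<omega> in P. \<omega> \<in> (\<Union>C. F C)" by (simp only: prob_eq_1[OF UF])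
  then show ?thesis
  proof eventually_elim
    case (elim \<omega>)
    then obtain C where "\<omega> \<in> F C" by blast
    then have "\<exists>\<^sub>F m in sequentially. legal m (k m) (m * m) \<omega> \<and> arrivals (T * 2 ^ k m) (sample (k m) \<omega>) 0 \<le> C"
      by (auto simp: F_def G_def elim!: frequently_elim1)
    then show ?case by blast
  qed
qed

lemma AE_initial:
  assumes "AE \<eta> in \<mu>. Q \<eta>" "sets \<mu> = sets borel"
  shows "AE \<omega> in P. Q (\<omega> 0)"
proof -
  have "distr P \<mu> (\<lambda>\<omega>. \<omega> 0) = \<mu>" using law by (simp add: markov_law_def)
  moreover have "(\<lambda>\<omega>. \<omega> 0) \<in> P \<rightarrow>\<^sub>M \<mu>"
    using measurable_coordinate[of 0] measurable_cong_sets[OF refl assms(2)] by blast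
  ultimately show ?thesis using assms(1) AE_distrD by metis
qed

end

section \<open>The theorem\<close>

text \<open>By right continuity in a discrete coordinate, the value at \<open>t\<close> persists for
  a short while, during which a dyadic time occurs.\<close>

lemma freezing_if_dyadic_frozen:
  assumes "cadlag \<omega>" and frozen: "\<And>i e. real T \<le> real i / 2 ^ e \<Longrightarrow> \<omega> (real i / 2 ^ e) x = \<omega> (real T) x"
  shows "freezing_time x \<omega> < \<infinity>"
proof -
  have "\<omega> t x = \<omega> (real T) x" if t: "real T \<le> t" for t
  proof -
    have "(\<omega> \<longlongrightarrow> \<omega> t) (at_right t)" using t assms(1) by (simp add: cadlag_def)
    moreover have "open ((\<lambda>\<eta> :: config. \<eta> x) -` {\<omega> t x})"
      by (intro open_vimage Topological_Spaces.open_discrete continuous_on_product_coordinates)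
    ultimately have "\<forall>\<^sub>F u in at_right t. \<omega> u \<in> (\<lambda>\<eta>. \<eta> x) -` {\<omega> t x}"
      by (rule topological_tendstoD) simp
    then obtain b where b: "t < b" "\<And>u. t < u \<Longrightarrow> u < b \<Longrightarrow> \<omega> u x = \<omega> t x"
      by (auto simp: eventually_at_right_field)
    obtain e :: nat where "(1 / 2) ^ e < b - t"
      using real_arch_pow_inv[of "b - t" "1 / 2"] b(1) by auto
    then have e: "1 / 2 ^ e < b - t" by (simp add: power_one_over)
    \<comment> \<open>The first grid index strictly after \<open>t\<close>; the point lies in
      \<open>(t, t + 1 / 2 ^ e]\<close>.\<close>
    define i where "i = nat (\<lfloor>t * 2 ^ e\<rfloor> + 1)"
    have "0 \<le> t" using t by (meson of_nat_0_le_iff order_trans)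
    then have "0 \<le> t * 2 ^ e" by simp
    then have "real i = real_of_int \<lfloor>t * 2 ^ e\<rfloor> + 1" by (simp add: i_def)
    then have "t * 2 ^ e < real i" "real i \<le> t * 2 ^ e + 1" by linarith+
    then have "t < real i / 2 ^ e" "real i / 2 ^ e \<le> t + 1 / 2 ^ e" by (simp_all add: field_simps)
    then show ?thesis using b(2)[of "real i / 2 ^ e"] frozen[of i e] e t by simp
  qed
  then show ?thesis unfolding freezing_time_finite_iff by (metis of_nat_0_le_iff)
qed

theorem theorem2:
  fixes \<rho> :: real and P :: "(real \<Rightarrow> config) measure"
  assumes "0 < \<rho>" and "\<rho> < 1"
    and "ftasep_law (bernoulli_product \<rho>) P"
  shows "measure P {\<omega> \<in> space P. freezing_time 0 \<omega> < \<infinity>} = (if \<rho> < 1/2 then 1 else 0)"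
proof -
  obtain S where S: "ftasep_semigroup S" "markov_law S (bernoulli_product \<rho>) P"
    using assms(3) unfolding ftasep_law_def by blast
  interpret ftasep_process S "bernoulli_product \<rho>" P
    by unfold_locales (rule S)+
  obtain k where grid: "\<forall>m. fine_grid m (k m)" using exists_fine_grid by blast
  then have k: "m \<le> k m" for m using fine_gridD(1)[of m "k m"] by simp
  have w: "m \<le> m * m" for m :: nat by simp
  have ev: "{\<omega> \<in> space P. freezing_time 0 \<omega> < \<infinity>} \<in> events"
    unfolding space_P sets_P by (rule freezing_event_measurable)
  show ?thesis
  proof (cases "\<rho> < 1 / 2")
    case True
    obtain c where c: "0 < c" and drift: "AE \<eta> in bernoulli_product \<rho>. \<forall>\<^sub>F n in sequentially.
        real_of_int (excess (- int n) 0 \<eta>) \<le> - 2 * c * real n"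
      using AE_excess_negative_drift[OF assms(1) True] .
    have "AE \<omega> in P. freezing_time 0 \<omega> < \<infinity>"
      using AE_initial[OF drift sets_bernoulli_product] AE_frequently_legal_small_inflow[OF grid c] AE_space
    proof eventually_elim
      case (elim \<omega>)
      have "\<exists>T. \<forall>i e. real T \<le> real i / 2 ^ e \<longrightarrow> sample e \<omega> i 0 = \<omega> (real T) 0"
        by (rule eventually_frozen[OF k w c elim(2,1)])
      then obtain T where "\<forall>i e. real T \<le> real i / 2 ^ e \<longrightarrow> sample e \<omega> i 0 = \<omega> (real T) 0" ..
      moreover have "cadlag \<omega>" using elim(3) by (simp add: space_P space_path_space)
      ultimately show ?case by (intro freezing_if_dyadic_frozen[of \<omega> T 0]) (simp_all add: sample_def)
    qed
    then have "prob {\<omega> \<in> space P. freezing_time 0 \<omega> < \<infinity>} = 1"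
      by (simp only: prob_Collect_eq_1[OF ev])
    then show ?thesis using True by simp
  next
    case False
    then have "1 / 2 \<le> \<rho>" by simp
    have inflow: "AE \<omega> in P. \<forall>T. \<exists>C::nat. \<exists>\<^sub>F m in sequentially. legal m (k m) (m * m) \<omega> \<and>
        arrivals (T * 2 ^ k m) (sample (k m) \<omega>) 0 \<le> C"
      unfolding AE_all_countable by (intro allI AE_frequently_legal_bounded_inflow[OF grid])
    have jumps: "AE \<omega> in P. \<forall>x T. \<exists>i e. real T \<le> real i / 2 ^ e \<and>
        \<not> (sample e \<omega> i (x - 1) \<and> sample e \<omega> i x \<and> \<not> sample e \<omega> i (x + 1))"
      unfolding AE_all_countable by (intro allI AE_jump_happens)
    have "AE \<omega> in P. \<not> freezing_time 0 \<omega> < \<infinity>"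
      using AE_initial[OF AE_excess_unbounded[OF \<open>1 / 2 \<le> \<rho>\<close> assms(2)] sets_bernoulli_product]
        AE_initial[OF AE_holes[OF assms(1,2)] sets_bernoulli_product] inflow jumps
    proof eventually_elim
      case (elim \<omega>)
      show ?case
        unfolding freezing_time_finite_iff
        by (rule never_frozen[OF k w elim(3)[rule_format] elim(4)[rule_format]
              elim(1)[rule_format] elim(2)[rule_format]])
    qed
    then have "prob {\<omega> \<in> space P. freezing_time 0 \<omega> < \<infinity>} = 0"
      by (simp only: prob_Collect_eq_0[OF ev])
    then show ?thesis using False by simp
  qed
qed

end
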